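(* There exists a deterministic streaming algorithm for monotone maximum submodular matching (monotone \textsc{MSM}) which runs in time quasilinear in the number of edges $|E|$ (times the time of a value-oracle evaluation of $f$) and is $(3+2\sqrt{2})\approx 5.828$ approximate, i.e., it always outputs a matching $M$ with $f(M)\geq \frac{1}{3+2\sqrt{2}}\, f(OPT)$, where $OPT$ is a maximum-value matching.
   Context: An instance of \textsc{MSM} consists of an $n$-vertex graph $G=(V,E)$ and a non-negative submodular set function $f:2^E\to\mathbb{R}_{\geq 0}$ (submodular: $f(S\cup\{e\})-f(S)\geq f(T\cup\{e\})-f(T)$ for $S\subseteq T\subseteq E$, $e\notin T$), accessed through a value oracle; $f$ is monotone if $f(S)\le f(T)$ whenever $S\subseteq T$. Feasible solutions are matchings of $G$, and the goal is to maximize $f$. In the streaming model the edges of $E$ arrive one at a time in an arbitrary order, and the algorithm must output a matching at the end of the stream using space $\tilde O(M_{\max})$, where $M_{\max}$ is the maximum size of a matching in $G$; the algorithm may query the oracle only on subsets currently stored in memory. It is assumed that $f$ is polynomially bounded: $f_{\max}/f_{\min}=n^{O(1)}$, where $f_{\max}=\max_{e\in E}f(\{e\})$ and $f_{\min}$ is the minimum nonzero value of $f(S\cup\{e\})-f(S)$ over $e\in E$, $S\subseteq E$. *)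

theory Defs
  imports Complex_Main "HOL-Library.Disjoint_Sets"
begin

section \<open>Submodular matching instances\<close>

text \<open>Vertices are the labels \<open>0, \<dots>, n - 1\<close>; an edge is a two-element set of vertices.\<close>

type_synonym edge = "nat set"

definition graph :: "nat \<Rightarrow> edge set \<Rightarrow> bool" where
  "graph n E \<longleftrightarrow> (\<forall>e\<in>E. e \<subseteq> {..<n} \<and> card e = 2)"

definition matching :: "edge set \<Rightarrow> edge set \<Rightarrow> bool" where
  "matching E M \<longleftrightarrow> M \<subseteq> E \<and> disjoint M"

definition M_max :: "edge set \<Rightarrow> nat" where
  "M_max E = Max (card ` {M. matching E M})"

definition submodular_on :: "edge set \<Rightarrow> (edge set \<Rightarrow> real) \<Rightarrow> bool" where
  "submodular_on E f \<longleftrightarrow>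
     (\<forall>S T e. S \<subseteq> T \<longrightarrow> T \<subseteq> E \<longrightarrow> e \<in> E \<longrightarrow> e \<notin> T \<longrightarrow>
        f (S \<union> {e}) - f S \<ge> f (T \<union> {e}) - f T)"

definition nonneg_on :: "edge set \<Rightarrow> (edge set \<Rightarrow> real) \<Rightarrow> bool" where
  "nonneg_on E f \<longleftrightarrow> (\<forall>S\<subseteq>E. 0 \<le> f S)"

definition nonzero_marginals :: "edge set \<Rightarrow> (edge set \<Rightarrow> real) \<Rightarrow> real set" where
  "nonzero_marginals E f = {f (S \<union> {e}) - f S | e S. e \<in> E \<and> S \<subseteq> E} - {0}"

definition f_max :: "edge set \<Rightarrow> (edge set \<Rightarrow> real) \<Rightarrow> real" where
  "f_max E f = Max ((\<lambda>e. f {e}) ` E)"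

definition f_min :: "edge set \<Rightarrow> (edge set \<Rightarrow> real) \<Rightarrow> real" where
  "f_min E f = Min (nonzero_marginals E f)"

text \<open>If \<open>f\<close> is constant then \<open>f_min\<close> does not exist and nothing is required.\<close>

definition poly_bounded :: "nat \<Rightarrow> nat \<Rightarrow> edge set \<Rightarrow> (edge set \<Rightarrow> real) \<Rightarrow> bool" where
  "poly_bounded d n E f \<longleftrightarrow>
     (nonzero_marginals E f \<noteq> {} \<longrightarrow> f_max E f / f_min E f \<le> real n ^ d)"

section \<open>Machine model\<close>

text \<open>
  A random access machine with integer words and words holding values of \<open>f\<close>, programmed by
  while programs. There is no conversion between the two kinds of words. Values can only be
  obtained from the oracle, added, subtracted, and compared (a test compares two products, that
  is, two ratios); together with the bound on their magnitude in \<open>fits_words\<close> below, this keeps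
  a program from packing the stream into the digits of a single real number.
  Programs contain no real constants.
\<close>

datatype iexp =
    Const nat
  | ILoad iexp
  | IAdd iexp iexp
  | ISub iexp iexp
  | IMul iexp iexp
  | IDiv iexp iexp

datatype rexp =
    RLoad iexp
  | RAdd rexp rexp
  | RSub rexp rexp

datatype bexp =
    ILess iexp iexp
  | RProdLess rexp rexp rexp rexp
  | BNot bexp
  | BAnd bexp bexp

datatype com =
    Skip
  | IStore iexp iexp
  | RStore iexp rexp
  | Query iexp iexp iexp
  | Seq com com
  | Cond bexp com com
  | While bexp com

record memory =
  ints :: "nat \<Rightarrow> nat"
  reals :: "nat \<Rightarrow> real"

primrec ival :: "iexp \<Rightarrow> memory \<Rightarrow> nat" where
  "ival (Const c) s = c"
| "ival (ILoad a) s = ints s (ival a s)"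
| "ival (IAdd a b) s = ival a s + ival b s"
| "ival (ISub a b) s = ival a s - ival b s"
| "ival (IMul a b) s = ival a s * ival b s"
| "ival (IDiv a b) s = ival a s div ival b s"

primrec rval :: "rexp \<Rightarrow> memory \<Rightarrow> real" where
  "rval (RLoad a) s = reals s (ival a s)"
| "rval (RAdd a b) s = rval a s + rval b s"
| "rval (RSub a b) s = rval a s - rval b s"

primrec bval :: "bexp \<Rightarrow> memory \<Rightarrow> bool" where
  "bval (ILess a b) s \<longleftrightarrow> ival a s < ival b s"
| "bval (RProdLess a b c d) s \<longleftrightarrow> rval a s * rval b s < rval c s * rval d s"
| "bval (BNot b) s \<longleftrightarrow> \<not> bval b s"
| "bval (BAnd b c) s \<longleftrightarrow> bval b s \<and> bval c s"

text \<open>The \<open>k\<close> edges stored in consecutive pairs of integer cells from address \<open>b\<close> on.\<close>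

definition stored_edges :: "memory \<Rightarrow> nat \<Rightarrow> nat \<Rightarrow> edge set" where
  "stored_edges s b k = (\<lambda>i. {ints s (b + 2 * i), ints s (b + 2 * i + 1)}) ` {..<k}"

text \<open>
  \<open>exec f A c s tr s'\<close>: when the edges in \<open>A\<close> have arrived, \<open>c\<close> started in \<open>s\<close> terminates
  in \<open>s'\<close>, and \<open>tr\<close> lists the memory contents after each elementary step. Hence \<open>length tr\<close>
  is the running time (an oracle call being one step), and the space used is the maximum over
  \<open>tr\<close>. A query is possible only on a set of edges that is stored in memory and whose
  elements have arrived; any other query blocks.
\<close>

inductive exec ::
  "(edge set \<Rightarrow> real) \<Rightarrow> edge set \<Rightarrow> com \<Rightarrow> memory \<Rightarrow> memory list \<Rightarrow> memory \<Rightarrow> bool"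
  for f :: "edge set \<Rightarrow> real" and A :: "edge set"
where
  Skip: "exec f A Skip s [s] s"
| IStore: "s' = s\<lparr>ints := (ints s)(ival a s := ival e s)\<rparr> \<Longrightarrow>
    exec f A (IStore a e) s [s'] s'"
| RStore: "s' = s\<lparr>reals := (reals s)(ival a s := rval e s)\<rparr> \<Longrightarrow>
    exec f A (RStore a e) s [s'] s'"
| Query: "X = stored_edges s (ival b s) (ival k s) \<Longrightarrow> X \<subseteq> A \<Longrightarrow>
    s' = s\<lparr>reals := (reals s)(ival a s := f X)\<rparr> \<Longrightarrow>
    exec f A (Query a b k) s [s'] s'"
| Seq: "exec f A c1 s tr1 s1 \<Longrightarrow> exec f A c2 s1 tr2 s2 \<Longrightarrow>
    exec f A (Seq c1 c2) s (tr1 @ tr2) s2"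
| CondTrue: "bval b s \<Longrightarrow> exec f A c1 s tr s' \<Longrightarrow> exec f A (Cond b c1 c2) s (s # tr) s'"
| CondFalse: "\<not> bval b s \<Longrightarrow> exec f A c2 s tr s' \<Longrightarrow> exec f A (Cond b c1 c2) s (s # tr) s'"
| WhileFalse: "\<not> bval b s \<Longrightarrow> exec f A (While b c) s [s] s"
| WhileTrue: "bval b s \<Longrightarrow> exec f A c s tr1 s1 \<Longrightarrow> exec f A (While b c) s1 tr2 s2 \<Longrightarrow>
    exec f A (While b c) s (s # tr1 @ tr2) s2"

section \<open>Streaming algorithms\<close>

text \<open>
  The integer cells \<open>0\<close> and \<open>1\<close> receive the endpoints of the arriving edge, cell \<open>2\<close>
  initially contains \<open>n\<close>, and all other cells are blank, that is, \<open>0\<close>. In the end the cells \<open>0\<close>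
  and \<open>1\<close> contain the address and the number of the edges of the output.
\<close>

record stream_alg =
  init :: com
  on_edge :: com
  finish :: com

definition start :: "nat \<Rightarrow> memory" where
  "start n = \<lparr>ints = (\<lambda>_. 0)(2 := n), reals = (\<lambda>_. 0)\<rparr>"

definition receive :: "nat \<Rightarrow> nat \<Rightarrow> memory \<Rightarrow> memory" where
  "receive u v s = s\<lparr>ints := (ints s)(0 := u, 1 := v)\<rparr>"

inductive process ::
  "(edge set \<Rightarrow> real) \<Rightarrow> com \<Rightarrow> edge set \<Rightarrow> (nat \<times> nat) list \<Rightarrow> memory \<Rightarrow> memory list \<Rightarrow> memory \<Rightarrow> bool"
  for f :: "edge set \<Rightarrow> real" and c :: com
where
  Nil: "process f c A [] s [] s"
| Cons: "s0 = receive u v s \<Longrightarrow> A' = insert {u, v} A \<Longrightarrow> exec f A' c s0 tr1 s1 \<Longrightarrow>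
    process f c A' xs s1 tr2 s2 \<Longrightarrow>
    process f c A ((u, v) # xs) s (s0 # tr1 @ tr2) s2"

definition stream_edges :: "(nat \<times> nat) list \<Rightarrow> edge list" where
  "stream_edges xs = map (\<lambda>(u, v). {u, v}) xs"

definition is_stream_of :: "edge set \<Rightarrow> (nat \<times> nat) list \<Rightarrow> bool" where
  "is_stream_of E xs \<longleftrightarrow> distinct (stream_edges xs) \<and> set (stream_edges xs) = E"

definition runs ::
  "stream_alg \<Rightarrow> (edge set \<Rightarrow> real) \<Rightarrow> nat \<Rightarrow> (nat \<times> nat) list \<Rightarrow> memory list \<Rightarrow> edge set \<Rightarrow> bool" where
  "runs alg f n xs tr M \<longleftrightarrow>
     (\<exists>tr1 s1 tr2 s2 tr3 s3.
        exec f {} (init alg) (start n) tr1 s1 \<and>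
        process f (on_edge alg) {} xs s1 tr2 s2 \<and>
        exec f (set (stream_edges xs)) (finish alg) s2 tr3 s3 \<and>
        tr = start n # tr1 @ tr2 @ tr3 \<and>
        M = stored_edges s3 (ints s3 0) (ints s3 1))"

text \<open>
  The contents of the memory are determined by the nonblank cells and their addresses, so space
  is the number of nonblank cells, provided that addresses and contents fit into machine words.
\<close>

definition space :: "memory \<Rightarrow> nat" where
  "space s = card {a. ints s a \<noteq> 0} + card {a. reals s a \<noteq> 0}"

definition fits_words :: "nat \<Rightarrow> real \<Rightarrow> memory \<Rightarrow> bool" where
  "fits_words N F s \<longleftrightarrow>
     (\<forall>a. ints s a \<noteq> 0 \<longrightarrow> a \<le> N \<and> ints s a \<le> N) \<and>
     (\<forall>a. reals s a \<noteq> 0 \<longrightarrow> a \<le> N \<and> \<bar>reals s a\<bar> \<le> real N * F)"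

section \<open>Runs are deterministic\<close>

inductive_cases exec_elims:
  "exec f A Skip s tr s'"
  "exec f A (IStore a e) s tr s'"
  "exec f A (RStore a e') s tr s'"
  "exec f A (Query a b k) s tr s'"
  "exec f A (Seq c1 c2) s tr s'"
  "exec f A (Cond b' c1 c2) s tr s'"

inductive_cases exec_While_elim: "exec f A (While b c) s tr s'"

lemma exec_deterministic:
  "exec f A c s tr s' \<Longrightarrow> exec f A c s tr' s'' \<Longrightarrow> tr' = tr \<and> s'' = s'"
proof (induction arbitrary: tr' s'' rule: exec.induct)
  case (Seq c1 s tr1 s1 c2 tr2 s2)
  from Seq.prems obtain t1 u1 t2 where
    "exec f A c1 s t1 u1" "exec f A c2 u1 t2 s''" "tr' = t1 @ t2"
    by (auto elim: exec_elims)
  with Seq.IH show ?case by metis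
next
  case (WhileTrue b s c tr1 s1 tr2 s2)
  from WhileTrue.prems WhileTrue.hyps(1) obtain t1 u1 t2 where
    "exec f A c s t1 u1" "exec f A (While b c) u1 t2 s''" "tr' = s # t1 @ t2"
    by (auto elim: exec_While_elim)
  with WhileTrue.IH show ?case by metis
next
  case (WhileFalse b s c)
  from WhileFalse.prems WhileFalse.hyps show ?case by (auto elim: exec_While_elim)
next
  case (CondTrue b s c1 tr s' c2)
  from CondTrue.prems CondTrue.hyps(1) obtain t where "exec f A c1 s t s''" "tr' = s # t"
    by (auto elim: exec_elims)
  with CondTrue.IH show ?case by metis
next
  case (CondFalse b s c2 tr s' c1)
  from CondFalse.prems CondFalse.hyps(1) obtain t where "exec f A c2 s t s''" "tr' = s # t"
    by (auto elim: exec_elims)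
  with CondFalse.IH show ?case by metis
qed (auto elim: exec_elims)

inductive_cases process_elims:
  "process f c A [] s tr s'"
  "process f c A (x # xs) s tr s'"

lemma process_deterministic:
  "process f c A xs s tr s' \<Longrightarrow> process f c A xs s tr' s'' \<Longrightarrow> tr' = tr \<and> s'' = s'"
proof (induction arbitrary: tr' s'' rule: process.induct)
  case (Nil A s)
  then show ?case by (auto elim: process_elims)
next
  case (Cons s0 u v s A' A tr1 s1 xs tr2 s2)
  from Cons.prems Cons.hyps(1,2) obtain t1 u1 t2 where
    "exec f A' c s0 t1 u1" "process f c A' xs u1 t2 s''" "tr' = s0 # t1 @ t2"
    by (auto elim: process_elims)
  moreover from this Cons.hyps(3) have "t1 = tr1 \<and> u1 = s1"
    by (metis exec_deterministic)
  ultimately show ?case using Cons.IH by metis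
qed

lemma runs_deterministic:
  assumes "runs alg f n xs tr M" and "runs alg f n xs tr' M'"
  shows "tr' = tr \<and> M' = M"
proof -
  obtain t1 s1 t2 s2 t3 s3 where r:
    "exec f {} (init alg) (start n) t1 s1"
    "process f (on_edge alg) {} xs s1 t2 s2"
    "exec f (set (stream_edges xs)) (finish alg) s2 t3 s3"
    "tr = start n # t1 @ t2 @ t3" "M = stored_edges s3 (ints s3 0) (ints s3 1)"
    using assms(1) unfolding runs_def by blast
  obtain t1' s1' t2' s2' t3' s3' where r':
    "exec f {} (init alg) (start n) t1' s1'"
    "process f (on_edge alg) {} xs s1' t2' s2'"
    "exec f (set (stream_edges xs)) (finish alg) s2' t3' s3'"
    "tr' = start n # t1' @ t2' @ t3'" "M' = stored_edges s3' (ints s3' 0) (ints s3' 1)"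
    using assms(2) unfolding runs_def by blast
  have 1: "t1' = t1" "s1' = s1"
    using exec_deterministic[OF r(1) r'(1)] by auto
  have 2: "t2' = t2" "s2' = s2"
    using process_deterministic[OF r(2) r'(2)[unfolded 1]] by auto
  have 3: "t3' = t3" "s3' = s3"
    using exec_deterministic[OF r(3) r'(3)[unfolded 2]] by auto
  show ?thesis using r r' 1 2 3 by simp
qed

end

theory Submission
  imports Defs
begin

text \<open>
  The algorithm keeps a stack \<open>S\<close> of edges and a potential \<open>\<phi> v\<close> for every vertex. An arriving edge
  \<open>e = {u, v}\<close> with marginal value \<open>x = f (S \<union> {e}) - f S\<close> is pushed iff \<open>x > C (\<phi> u + \<phi> v)\<close>, and then
  both potentials grow by the weight \<open>w = x - \<phi> u - \<phi> v\<close>. At the end the stack is popped greedily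
  into a matching \<open>M\<close>. Let \<open>W\<close> be the total weight, so that the potentials add up to \<open>2 W\<close>.

  Every edge of \<open>S\<close> is in \<open>M\<close> or blocked by a later edge of \<open>M\<close>, and the marginal value of an
  edge of \<open>M\<close> pays for its own weight and for the weights of the earlier edges at its endpoints;
  hence \<open>f M \<ge> f {} + W\<close>. Pushed edges satisfy \<open>x \<le> C / (C - 1) w\<close>, hence
  \<open>f S \<le> f {} + C / (C - 1) W\<close>. The marginal values of rejected edges are at most
  \<open>C (\<phi> u + \<phi> v)\<close>, so a matching adds at most \<open>2 C W\<close> to \<open>f S\<close>. The resulting ratio
  \<open>2 C + C / (C - 1)\<close> is minimal, and equal to \<open>3 + 2 \<surd>2\<close>, at \<open>C = 1 + 1 / \<surd>2\<close>.

  Each push multiplies the potentials of its endpoints by at least \<open>C\<close>, so every vertex is in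
  \<open>O (log (f_max / f_min))\<close> edges of the stack, and all these edges meet the at most \<open>2 M_max\<close>
  vertices of a maximal matching.
\<close>

section \<open>Greedy matchings of a stack\<close>

definition edge_set :: "(nat \<times> nat) list \<Rightarrow> edge set" where
  "edge_set S = set (stream_edges S)"

definition deg :: "(nat \<times> nat) list \<Rightarrow> nat \<Rightarrow> nat" where
  "deg S v = length (filter (\<lambda>e. v \<in> e) (stream_edges S))"

text \<open>\<open>B\<close> holds the vertices already covered. The algorithm uses
  \<open>greedy\<close> on \<open>rev S\<close>, so the edge pushed last is decided first.\<close>

fun greedy :: "nat set \<Rightarrow> (nat \<times> nat) list \<Rightarrow> edge set" where
  "greedy B [] = {}"
| "greedy B ((u, v) # ys) =
     (if u \<in> B \<or> v \<in> B then greedy B ys else insert {u, v} (greedy (B \<union> {u, v}) ys))"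

lemma edge_set_simps [simp]:
  "edge_set [] = {}"
  "edge_set ((u, v) # S) = insert {u, v} (edge_set S)"
  "edge_set (S @ T) = edge_set S \<union> edge_set T"
  "edge_set (rev S) = edge_set S"
  by (auto simp: edge_set_def stream_edges_def)

lemma deg_simps [simp]:
  "deg [] v = 0"
  "deg ((a, b) # S) v = (if v \<in> {a, b} then 1 else 0) + deg S v"
  "deg (S @ T) v = deg S v + deg T v"
  by (auto simp: deg_def stream_edges_def)

lemma greedy_subset: "greedy B ys \<subseteq> edge_set ys"
  by (induction B ys rule: greedy.induct) auto

lemma greedy_avoids: "e \<in> greedy B ys \<Longrightarrow> e \<inter> B = {}"
  by (induction B ys rule: greedy.induct) (auto split: if_splits)

lemma disjoint_greedy: "disjoint (greedy B ys)"
proof (induction B ys rule: greedy.induct)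
  case (2 B u v ys)
  have "e \<inter> {u, v} = {}" if "e \<in> greedy (B \<union> {u, v}) ys" for e
    using greedy_avoids[OF that] by blast
  with 2 show ?case
    by (auto simp: disjoint_def pairwise_insert disjnt_def)
qed auto

text \<open>An edge is skipped only if one of its endpoints is already covered. With
  \<open>B\<close> empty, the vertices of the greedy matching therefore form a vertex cover of the
  list.\<close>

lemma greedy_maximal:
  "(u, v) \<in> set ys \<Longrightarrow> {u, v} \<inter> (B \<union> \<Union>(greedy B ys)) \<noteq> {}"
  by (induction B ys rule: greedy.induct) (auto 0 3)

text \<open>Each edge has an endpoint in the vertex cover \<open>T\<close> and is thus counted at
  least once in the degree sum.\<close>

lemma length_le_sum_deg:
  assumes "finite T" and "\<And>u v. (u, v) \<in> set S \<Longrightarrow> {u, v} \<inter> T \<noteq> {}"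
  shows "length S \<le> (\<Sum>v\<in>T. deg S v)"
  using assms(2)
proof (induction S)
  case (Cons e S)
  obtain a b where e: "e = (a, b)" by fastforce
  have "card ({a, b} \<inter> T) \<noteq> 0"
    using Cons.prems[of a b] assms(1) e by simp
  moreover have "(\<Sum>v\<in>T. if v \<in> {a, b} then 1 else 0 :: nat) = card ({a, b} \<inter> T)"
    using assms(1) by (subst sum.inter_restrict[symmetric]) (auto simp: Int_commute)
  moreover have "(\<Sum>v\<in>T. deg (e # S) v) =
      (\<Sum>v\<in>T. if v \<in> {a, b} then 1 else 0) + (\<Sum>v\<in>T. deg S v)"
    unfolding e deg_simps by (rule sum.distrib)
  ultimately show ?case using Cons by fastforce
qed simp

section \<open>The potential invariant\<close>

definition C :: real where "C = 1 + 1 / sqrt 2"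

lemma C_gt_1: "C > 1" by (simp add: C_def)

lemma C_pos [simp]: "C > 0" "C \<ge> 0" using C_gt_1 by auto

text \<open>This is \<open>C / (C - 1) = 1 + sqrt 2\<close>, cleared of the division.\<close>

lemma C_ratio: "C = (1 + sqrt 2) * (C - 1)"
  by (simp add: C_def field_simps)

lemma two_C: "2 * C + (1 + sqrt 2) = 3 + 2 * sqrt 2"
  by (simp add: C_def field_simps)

text \<open>The loss from a marginal value to its weight is thereby at most two factors
  \<open>C\<close>. Together with one factor for the first edge at a vertex, they make up the
  \<open>C ^ 3\<close> in \<open>inv\<close>.\<close>

lemma C_sq: "C\<^sup>2 \<ge> 1 + sqrt 2"
proof -
  have "C\<^sup>2 = 1 + 2 / sqrt 2 + 1 / 2"
    by (simp add: C_def power2_eq_square field_simps)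
  also have "2 / sqrt 2 = sqrt 2" by (simp add: real_div_sqrt)
  finally show ?thesis by simp
qed

text \<open>The machine has no real constants and compares products only, so it tests the squared form.\<close>

lemma C_test:
  assumes "0 \<le> y" and "0 \<le> x"
  shows "C * y < x \<longleftrightarrow> 0 < (x - y) * x \<and> y * y < ((x - y) + (x - y)) * (x - y)"
proof -
  define D where "D = x - y"
  have 1: "C * y < x \<longleftrightarrow> y < sqrt 2 * D"
    by (simp add: C_def D_def field_simps)
  \<comment> \<open>Squaring \<open>y < sqrt 2 * D\<close> is sound only for positive
    \<open>D\<close>. As \<open>x \<ge> 0\<close>, the sign of \<open>D\<close> can be read off from
    the product \<open>D * x\<close>.\<close>
  show ?thesis
  proof (cases "D > 0")
    case True
    then have "y < sqrt 2 * D \<longleftrightarrow> y\<^sup>2 < (sqrt 2 * D)\<^sup>2"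
      using assms by (metis mult_nonneg_nonneg less_imp_le real_sqrt_ge_zero zero_le_numeral
          power2_less_imp_less power_strict_mono zero_less_numeral)
    moreover have "(sqrt 2 * D)\<^sup>2 = (D + D) * D"
      by (simp add: power_mult_distrib power2_eq_square)
    moreover have "x > 0" using True assms D_def by simp
    ultimately show ?thesis
      using 1 True unfolding D_def[symmetric] by (simp add: power2_eq_square[of y])
  next
    case False
    have "\<not> y < sqrt 2 * D"
      using False assms by (smt (verit) mult_nonneg_nonpos real_sqrt_ge_zero)
    moreover have "\<not> (0 < D * x \<and> y * y < (D + D) * D)"
      using False assms(2) by (simp add: zero_less_mult_iff)
    ultimately show ?thesis using 1 unfolding D_def by simp
  qed
qed


section \<open>Values and marginals of a monotone submodular function\<close>

locale msm =
  fixes n :: nat and E :: "edge set" and f :: "edge set \<Rightarrow> real"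
  assumes graph: "graph n E"
    and nonneg: "nonneg_on E f"
    and submodular: "submodular_on E f"
    and mono: "mono_on (Pow E) f"
begin

lemma finite_E: "finite E"
proof (rule finite_subset)
  show "E \<subseteq> Pow {..<n}" using graph unfolding graph_def by auto
qed simp

lemma card_E: "card E \<le> n\<^sup>2"
proof -
  have "E \<subseteq> (\<lambda>(u, v). {u, v}) ` ({..<n} \<times> {..<n})"
  proof
    fix e assume "e \<in> E"
    then have "e \<subseteq> {..<n}" "card e = 2" using graph unfolding graph_def by auto
    then obtain u v where "e = {u, v}" "u < n" "v < n"
      by (auto simp: card_2_iff)
    then show "e \<in> (\<lambda>(u, v). {u, v}) ` ({..<n} \<times> {..<n})" by auto
  qed
  then have "card E \<le> card ({..<n} \<times> {..<n})"
    by (rule surj_card_le[rotated]) simp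
  then show ?thesis by (simp add: power2_eq_square)
qed

lemma edgeD:
  assumes "{u, v} \<in> E"
  shows "u < n" "v < n" "u \<noteq> v"
proof -
  have "{u, v} \<subseteq> {..<n}" "card {u, v} = 2"
    using assms graph unfolding graph_def by blast+
  then show "u < n" "v < n" "u \<noteq> v" by (auto simp: card_insert_if split: if_splits)
qed

lemma f_mono: "S \<subseteq> T \<Longrightarrow> T \<subseteq> E \<Longrightarrow> f S \<le> f T"
  using mono by (auto simp: mono_on_def)

text \<open>Submodularity speaks of \<open>e \<notin> T\<close> only. For \<open>e \<in> T\<close>
  the marginal value on \<open>T\<close> is 0, and monotonicity makes the one on \<open>S\<close>
  nonnegative.\<close>

lemma marginal_antimono:
  assumes "S \<subseteq> T" "T \<subseteq> E" "e \<in> E"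
  shows "f (insert e T) - f T \<le> f (insert e S) - f S"
proof (cases "e \<in> T")
  case True
  then show ?thesis using f_mono[of S "insert e S"] assms by (auto simp: insert_absorb)
next
  case False
  then show ?thesis using submodular assms unfolding submodular_on_def by force
qed

text \<open>The elements of \<open>R - S\<close> are added one at a time, and each gains at most
  what it gains on \<open>S\<close> alone.\<close>

lemma f_Un_le:
  assumes "S \<subseteq> E" "R \<subseteq> E"
  shows "f (S \<union> R) \<le> f S + (\<Sum>e\<in>R - S. f (insert e S) - f S)"
proof -
  have "finite R" using assms finite_E finite_subset by blast
  then show ?thesis using assms(2)
  proof (induction R rule: finite_induct)
    case (insert e R)
    show ?case
    proof (cases "e \<in> S")
      case True
      then have "S \<union> insert e R = S \<union> R" "insert e R - S = R - S" by auto
      then show ?thesis using insert by simp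
    next
      case False
      then have *: "insert e R - S = insert e (R - S)" "e \<notin> R - S" using insert by auto
      have "f (insert e (S \<union> R)) - f (S \<union> R) \<le> f (insert e S) - f S"
        using marginal_antimono[of S "S \<union> R" e] insert.prems assms by auto
      then show ?thesis using insert * by simp
    qed
  qed simp
qed

lemma f_singleton_le: "e \<in> E \<Longrightarrow> f {e} \<le> f_max E f"
  unfolding f_max_def using finite_E by auto

lemma f_empty_nonneg: "0 \<le> f {}"
  using nonneg by (simp add: nonneg_on_def)

lemma f_max_nonneg: "E \<noteq> {} \<Longrightarrow> 0 \<le> f_max E f"
  using f_singleton_le nonneg unfolding nonneg_on_def
  by (metis bot.extremum equals0I insert_subset order.trans)

text \<open>\<open>f X\<close> is at most \<open>f {}\<close> plus the marginal values of the single
  edges over the empty set, and each of these terms is at most \<open>f_max E f\<close>. This is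
  what makes oracle answers fit into machine words.\<close>

lemma f_le:
  assumes "X \<subseteq> E" "E \<noteq> {}"
  shows "f X \<le> (real (card E) + 1) * f_max E f"
proof -
  obtain e where e: "e \<in> E" using assms by auto
  have m: "f {e} - f {} \<le> f_max E f" if "e \<in> E" for e
    using f_singleton_le[OF that] f_empty_nonneg by simp
  have "f X \<le> f {} + (\<Sum>e\<in>X. f {e} - f {})"
    using f_Un_le[of "{}" X] assms by simp
  also have "(\<Sum>e\<in>X. f {e} - f {}) \<le> real (card X) * f_max E f"
    using m assms by (intro sum_bounded_above) auto
  also have "\<dots> \<le> real (card E) * f_max E f"
    using assms card_mono[OF finite_E] f_max_nonneg by (intro mult_right_mono) auto
  also have "f {} \<le> f_max E f"
    using f_mono[of "{}" "{e}"] f_singleton_le[OF e] e by simp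
  finally show ?thesis by (simp add: algebra_simps)
qed

lemma finite_marginals: "finite (nonzero_marginals E f)"
proof -
  have "nonzero_marginals E f \<subseteq> (\<lambda>(e, S). f (S \<union> {e}) - f S) ` (E \<times> Pow E)"
    unfolding nonzero_marginals_def by auto
  then show ?thesis using finite_E finite_subset by blast
qed

text \<open>Monotonicity excludes negative marginals, so the least nonzero one is positive. A
  positive marginal also witnesses that the minimum is taken over a nonempty set.\<close>

lemma f_min_le:
  assumes "e \<in> E" "S \<subseteq> E" "0 < f (insert e S) - f S"
  shows "f_min E f \<le> f (insert e S) - f S" "0 < f_min E f" "nonzero_marginals E f \<noteq> {}"
proof -
  have *: "f (insert e S) - f S \<in> nonzero_marginals E f"
    using assms unfolding nonzero_marginals_def by force
  then show "f_min E f \<le> f (insert e S) - f S"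
    unfolding f_min_def using finite_marginals by simp
  show "nonzero_marginals E f \<noteq> {}" using * by auto
  then have "f_min E f \<in> nonzero_marginals E f"
    unfolding f_min_def using finite_marginals by simp
  then obtain e S where "e \<in> E" "S \<subseteq> E" "f_min E f = f (insert e S) - f S" "f_min E f \<noteq> 0"
    unfolding nonzero_marginals_def by auto
  then show "0 < f_min E f" using f_mono[of S "insert e S"] by (simp add: subset_insertI)
qed

text \<open>
  Half of the total potential is the total weight \<open>W\<close> pushed onto the stack. The quantifier over
  the blocked vertices \<open>B\<close> in the last conjunct is what makes it inductive: pushing an edge adds
  its endpoints to the vertices blocked for the rest of the stack.
\<close>

definition weight :: "(nat \<Rightarrow> real) \<Rightarrow> real" where
  "weight \<phi> = (\<Sum>v<n. \<phi> v) / 2"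

definition inv :: "edge set \<Rightarrow> (nat \<times> nat) list \<Rightarrow> (nat \<Rightarrow> real) \<Rightarrow> bool" where
  "inv P S \<phi> \<longleftrightarrow> P \<subseteq> E \<and> edge_set S \<subseteq> P \<and> distinct (stream_edges S) \<and>
     (\<forall>v. deg S v = 0 \<longrightarrow> \<phi> v = 0) \<and>
     (\<forall>v. 0 < deg S v \<longrightarrow> 0 < \<phi> v \<and> \<phi> v \<le> f_max E f \<and> nonzero_marginals E f \<noteq> {} \<and>
        0 < f_min E f \<and> C ^ deg S v * f_min E f \<le> C ^ 3 * \<phi> v) \<and>
     f (edge_set S) \<le> f {} + (1 + sqrt 2) * weight \<phi> \<and>
     (\<forall>e\<in>P - edge_set S. f (insert e (edge_set S)) - f (edge_set S) \<le> C * sum \<phi> e) \<and>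
     (\<forall>B\<subseteq>{..<n}. f {} + weight \<phi> \<le> f (greedy B (rev S)) + sum \<phi> B)"

section \<open>Preservation of the invariant and the approximation ratio\<close>

lemma inv_init: "inv {} [] (\<lambda>_. 0)"
  by (simp add: inv_def weight_def stream_edges_def)

lemma inv_nonneg: "inv P S \<phi> \<Longrightarrow> 0 \<le> \<phi> v"
  unfolding inv_def by (cases "deg S v = 0") (auto intro: less_imp_le)

text \<open>Only \<open>P\<close> changes, and the failed test is exactly what \<open>inv\<close>
  demands of a rejected edge.\<close>

lemma inv_skip:
  assumes "inv P S \<phi>" "{u, v} \<in> E" "{u, v} \<notin> P"
    and "f (insert {u, v} (edge_set S)) - f (edge_set S) \<le> C * (\<phi> u + \<phi> v)"
  shows "inv (insert {u, v} P) S \<phi>"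
  using assms edgeD[OF assms(2)] unfolding inv_def by auto

text \<open>The marginal value splits as \<open>x = w + (\<phi> u + \<phi> v)\<close>. Passing the
  test makes \<open>w\<close> a constant fraction of \<open>x\<close>, which controls the value of
  the stack and the degrees. Edges rejected earlier stay cheap, since their marginals only fall
  while potentials only rise.\<close>

lemma inv_push:
  assumes inv: "inv P S \<phi>" and e: "{u, v} \<in> E" "{u, v} \<notin> P"
    and x: "x = f (insert {u, v} (edge_set S)) - f (edge_set S)"
    and w: "w = x - (\<phi> u + \<phi> v)" and test: "C * (\<phi> u + \<phi> v) < x"
  shows "inv (insert {u, v} P) (S @ [(u, v)]) (\<phi>(u := \<phi> u + w, v := \<phi> v + w))"
    (is "inv _ _ ?\<phi>")
proof -
  note uv = edgeD[OF e(1)]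
  let ?S = "edge_set S" and ?e = "{u, v}"
  have SP: "?S \<subseteq> P" "P \<subseteq> E" and SE: "?S \<subseteq> E" using inv unfolding inv_def by auto
  have pos: "0 \<le> \<phi> z" for z using inv_nonneg[OF inv] .
  define y where "y = \<phi> u + \<phi> v"
  have y: "0 \<le> y" "\<phi> u \<le> y" "\<phi> v \<le> y" using pos by (auto simp: y_def)
  have wy: "(C - 1) * y \<le> w" "0 < w"
  proof -
    have "C * y < x" using test by (simp add: y_def)
    then show "(C - 1) * y \<le> w" by (simp add: w y_def algebra_simps)
    have "1 * y \<le> C * y" using C_gt_1 y by (intro mult_right_mono) auto
    with \<open>C * y < x\<close> show "0 < w" by (simp add: w y_def)
  qed
  \<comment> \<open>As \<open>C - 1 = 1 / sqrt 2\<close>, the bound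
    \<open>(C - 1) * y \<le> w\<close> gives \<open>y \<le> sqrt 2 * w\<close>, and
    \<open>x = w + y\<close>.\<close>
  have xw: "x \<le> (1 + sqrt 2) * w"
  proof -
    have "(1 + sqrt 2) * ((C - 1) * y) \<le> (1 + sqrt 2) * w"
      using wy by (intro mult_left_mono) auto
    then have "C * y \<le> (1 + sqrt 2) * w" using C_ratio by (simp add: mult.assoc[symmetric])
    moreover have "y \<le> sqrt 2 * w"
    proof -
      have "sqrt 2 * ((C - 1) * y) \<le> sqrt 2 * w" using wy by (intro mult_left_mono) auto
      then show ?thesis by (simp add: C_def)
    qed
    ultimately show ?thesis by (simp add: w y_def algebra_simps)
  qed
  have x0: "0 < x" using wy y w y_def by simp
  note fm = f_min_le[OF e(1) SE, folded x, OF x0]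
  have xmax: "x \<le> f_max E f"
    using marginal_antimono[of "{}" ?S ?e] SE e f_singleton_le[OF e(1)] f_empty_nonneg x by simp
  have le: "\<phi> z \<le> ?\<phi> z" for z using wy by simp
  have sum\<phi>: "sum ?\<phi> B = sum \<phi> B + w * real (card (B \<inter> ?e))" if "finite B" for B
  proof -
    have "?\<phi> z = \<phi> z + (if z \<in> ?e then w else 0)" for z using uv by auto
    then have "sum ?\<phi> B = (\<Sum>z\<in>B. \<phi> z + (if z \<in> ?e then w else 0))"
      by (intro sum.cong) auto
    also have "\<dots> = sum \<phi> B + (\<Sum>z\<in>B. if z \<in> ?e then w else 0)"
      by (rule sum.distrib)
    also have "(\<Sum>z\<in>B. if z \<in> ?e then w else 0) = w * real (card (B \<inter> ?e))"
      using that by (subst sum.inter_restrict[symmetric]) auto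
    finally show ?thesis .
  qed
  have W: "weight ?\<phi> = weight \<phi> + w"
  proof -
    have "{..<n} \<inter> ?e = ?e" using uv by auto
    then show ?thesis using sum\<phi>[of "{..<n}"] uv by (simp add: weight_def)
  qed
  have deg: "0 < ?\<phi> z \<and> ?\<phi> z \<le> f_max E f \<and>
      C ^ deg (S @ [(u, v)]) z * f_min E f \<le> C ^ 3 * ?\<phi> z" if "z \<in> ?e" for z
  proof (intro conjI)
    have \<phi>z: "?\<phi> z = \<phi> z + w" using that uv by auto
    show "0 < ?\<phi> z" using \<phi>z pos[of z] wy by simp
    \<comment> \<open>The new potential of \<open>u\<close> is \<open>x - \<phi> v\<close>, hence at
      most \<open>x\<close>; likewise for \<open>v\<close>.\<close>
    show "?\<phi> z \<le> f_max E f"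
      using that pos[of u] pos[of v] xmax uv by (auto simp: w)
    have d: "deg (S @ [(u, v)]) z = Suc (deg S z)" using that by auto
    show "C ^ deg (S @ [(u, v)]) z * f_min E f \<le> C ^ 3 * ?\<phi> z"
    proof (cases "deg S z = 0")
      case True
      \<comment> \<open>For the first edge at \<open>z\<close> no earlier potential can be
        multiplied, so the growth starts from \<open>f_min E f\<close>.\<close>
      have "f_min E f \<le> x" by (rule fm)
      also have "\<dots> \<le> (1 + sqrt 2) * w" by (rule xw)
      also have "\<dots> \<le> C\<^sup>2 * w" using C_sq wy by (intro mult_right_mono) auto
      also have "\<dots> \<le> C\<^sup>2 * ?\<phi> z" using \<phi>z pos[of z] by (intro mult_left_mono) auto
      finally have "C * f_min E f \<le> C * (C\<^sup>2 * ?\<phi> z)" by (intro mult_left_mono) auto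
      then show ?thesis unfolding d True by (simp add: power3_eq_cube power2_eq_square mult.assoc)
    next
      case False
      then have "C ^ deg S z * f_min E f \<le> C ^ 3 * \<phi> z" using inv unfolding inv_def by auto
      then have "C * (C ^ deg S z * f_min E f) \<le> C * (C ^ 3 * \<phi> z)"
        by (intro mult_left_mono) auto
      also have "\<dots> = C ^ 3 * (C * \<phi> z)" by simp
      \<comment> \<open>The increment \<open>w \<ge> (C - 1) * y\<close> is at least
        \<open>(C - 1) * \<phi> z\<close>, because \<open>z\<close> is one of the two vertices
        summed in \<open>y\<close>.\<close>
      also have "C * \<phi> z \<le> ?\<phi> z"
      proof -
        have "\<phi> z \<le> y" using that y by auto
        then have "(C - 1) * \<phi> z \<le> (C - 1) * y" using C_gt_1 by (intro mult_left_mono) auto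
        then show ?thesis using wy unfolding \<phi>z by (simp add: algebra_simps)
      qed
      then have "C ^ 3 * (C * \<phi> z) \<le> C ^ 3 * ?\<phi> z" by (intro mult_left_mono) auto
      finally show ?thesis unfolding d by (simp add: mult.assoc)
    qed
  qed
  show ?thesis
    unfolding inv_def
  proof (intro conjI allI impI ballI)
    show "insert ?e P \<subseteq> E" "edge_set (S @ [(u, v)]) \<subseteq> insert ?e P"
      using SP e by auto
    show "distinct (stream_edges (S @ [(u, v)]))"
      using inv e SP unfolding inv_def edge_set_def stream_edges_def by auto
    show "?\<phi> z = 0" if "deg (S @ [(u, v)]) z = 0" for z
      using that inv unfolding inv_def by (auto split: if_splits)
    fix z assume z: "0 < deg (S @ [(u, v)]) z"
    show "nonzero_marginals E f \<noteq> {}" "0 < f_min E f" by (rule fm)+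
    have "0 < ?\<phi> z \<and> ?\<phi> z \<le> f_max E f \<and>
        C ^ deg (S @ [(u, v)]) z * f_min E f \<le> C ^ 3 * ?\<phi> z"
    proof (cases "z \<in> ?e")
      case False
      then have "?\<phi> z = \<phi> z" "deg (S @ [(u, v)]) z = deg S z" by auto
      then show ?thesis using z inv unfolding inv_def by metis
    qed (rule deg)
    then show "0 < ?\<phi> z" "?\<phi> z \<le> f_max E f"
        "C ^ deg (S @ [(u, v)]) z * f_min E f \<le> C ^ 3 * ?\<phi> z"
      by blast+
  next
    have "f (edge_set (S @ [(u, v)])) = f ?S + x" using x by simp
    then show "f (edge_set (S @ [(u, v)])) \<le> f {} + (1 + sqrt 2) * weight ?\<phi>"
      using inv xw unfolding inv_def W by (simp add: algebra_simps)
  next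
    fix a assume "a \<in> insert ?e P - edge_set (S @ [(u, v)])"
    then have a: "a \<in> P" "a \<notin> ?S" "a \<in> E" using SP by auto
    have "f (insert a (insert ?e ?S)) - f (insert ?e ?S) \<le> f (insert a ?S) - f ?S"
      using marginal_antimono[of ?S "insert ?e ?S" a] a SE e by auto
    also have "\<dots> \<le> C * sum \<phi> a" using inv a unfolding inv_def by auto
    also have "\<dots> \<le> C * sum ?\<phi> a"
      by (intro mult_left_mono sum_mono le) auto
    finally show "f (insert a (edge_set (S @ [(u, v)]))) - f (edge_set (S @ [(u, v)]))
        \<le> C * sum ?\<phi> a" by simp
  next
    fix B assume B: "B \<subseteq> {..<n}"
    then have fB: "finite B" by (rule finite_subset) simp
    have IH: "f {} + weight \<phi> \<le> f (greedy B (rev S)) + sum \<phi> B" if "B \<subseteq> {..<n}" for B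
      using inv that unfolding inv_def by auto
    show "f {} + weight ?\<phi> \<le> f (greedy B (rev (S @ [(u, v)]))) + sum ?\<phi> B"
    proof (cases "u \<in> B \<or> v \<in> B")
      \<comment> \<open>The edge is skipped, but its blocked endpoint has raised
        \<open>sum \<phi> B\<close> by at least \<open>w\<close>.\<close>
      case True
      then have "card (B \<inter> ?e) \<noteq> 0" using fB by auto
      then have "1 \<le> real (card (B \<inter> ?e))" by linarith
      then have "w * 1 \<le> w * real (card (B \<inter> ?e))" using wy by (intro mult_left_mono) auto
      then show ?thesis using IH[OF B] True unfolding W sum\<phi>[OF fB] by simp
    next
      case False
      \<comment> \<open>The edge is taken. Blocking its endpoints for the rest costs
        \<open>y\<close> in the induction hypothesis, and the marginal value on \<open>?G\<close>,
        at least \<open>x = w + y\<close>, pays for this and for the new weight.\<close>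
      let ?G = "greedy (B \<union> ?e) (rev S)"
      have G: "?G \<subseteq> ?S" using greedy_subset[of "B \<union> ?e" "rev S"] by simp
      have "sum \<phi> (B \<union> ?e) = sum \<phi> B + y"
        using False fB uv by (subst sum.union_disjoint) (auto simp: y_def)
      moreover have "f {} + weight \<phi> \<le> f ?G + sum \<phi> (B \<union> ?e)"
        using B uv by (intro IH) auto
      moreover have "x \<le> f (insert ?e ?G) - f ?G"
        unfolding x using marginal_antimono[OF G SE e(1)] .
      moreover have "B \<inter> ?e = {}" using False by auto
      moreover have "greedy B (rev (S @ [(u, v)])) = insert ?e ?G" using False by simp
      ultimately show ?thesis unfolding W sum\<phi>[OF fB] by (simp add: w y_def)
    qed
  qed
qed

lemma matching_greedy: "inv P S \<phi> \<Longrightarrow> matching E (greedy B (rev S))"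
  using greedy_subset[of B "rev S"] disjoint_greedy[of B "rev S"]
  unfolding matching_def inv_def by auto

lemma greedy_approx:
  assumes inv: "inv E S \<phi>" and R: "matching E R"
  shows "f (greedy {} (rev S)) \<ge> 1 / (3 + 2 * sqrt 2) * f R"
proof -
  let ?S = "edge_set S"
  have SE: "?S \<subseteq> E" using inv unfolding inv_def by auto
  have RE: "R \<subseteq> E" "disjoint R" using R unfolding matching_def by auto
  have pos: "0 \<le> \<phi> z" for z using inv_nonneg[OF inv] .
  have fin: "finite e" "e \<subseteq> {..<n}" if "e \<in> E" for e
    using graph that unfolding graph_def by (auto intro: finite_subset)
  have "f R \<le> f (?S \<union> R)" using SE RE by (intro f_mono) auto
  also have "\<dots> \<le> f ?S + (\<Sum>e\<in>R - ?S. f (insert e ?S) - f ?S)"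
    using SE RE by (intro f_Un_le)
  also have "(\<Sum>e\<in>R - ?S. f (insert e ?S) - f ?S) \<le> (\<Sum>e\<in>R - ?S. C * sum \<phi> e)"
    using inv RE unfolding inv_def by (intro sum_mono) auto
  also have "\<dots> = C * (\<Sum>e\<in>R - ?S. sum \<phi> e)" by (simp add: sum_distrib_left)
  \<comment> \<open>The edges of \<open>R\<close> are disjoint, so the potential of each vertex is
    charged at most once.\<close>
  also have "(\<Sum>e\<in>R - ?S. sum \<phi> e) = sum \<phi> (\<Union>(R - ?S))"
    using RE fin by (subst sum.Union_disjoint) (auto simp: disjoint_def)
  also have "C * sum \<phi> (\<Union>(R - ?S)) \<le> C * (\<Sum>v<n. \<phi> v)"
    using RE fin pos by (intro mult_left_mono sum_mono2) auto
  also have "(\<Sum>v<n. \<phi> v) = 2 * weight \<phi>" by (simp add: weight_def)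
  also have "f ?S \<le> f {} + (1 + sqrt 2) * weight \<phi>" using inv unfolding inv_def by auto
  finally have "f R \<le> f {} + (2 * C + (1 + sqrt 2)) * weight \<phi>" by (simp add: algebra_simps)
  also have "\<dots> = f {} + (3 + 2 * sqrt 2) * weight \<phi>" unfolding two_C ..
  \<comment> \<open>The value of \<open>f {}\<close> is nonnegative, so it may be multiplied by the
    ratio as well.\<close>
  also have "\<dots> \<le> (3 + 2 * sqrt 2) * (f {} + weight \<phi>)"
  proof -
    have "1 * f {} \<le> (3 + 2 * sqrt 2) * f {}"
      using f_empty_nonneg by (intro mult_right_mono) auto
    then show ?thesis by (simp add: algebra_simps)
  qed
  also have "\<dots> \<le> (3 + 2 * sqrt 2) * f (greedy {} (rev S))"
    using inv unfolding inv_def by (intro mult_left_mono) auto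
  finally show ?thesis
    by (simp add: pos_divide_le_eq mult.commute add_pos_nonneg)
qed

section \<open>Length of the stack\<close>

lemma length_stack_le_card: "inv P S \<phi> \<Longrightarrow> length S \<le> card P"
proof -
  assume inv: "inv P S \<phi>"
  then have "length S = card (edge_set S)"
    unfolding inv_def edge_set_def by (metis distinct_card length_map stream_edges_def)
  also have "\<dots> \<le> card P"
    using inv finite_E unfolding inv_def by (intro card_mono) (auto intro: finite_subset)
  finally show ?thesis .
qed

text \<open>The chain \<open>C ^ deg S v * f_min \<le> C ^ 3 * \<phi> v \<le> C ^ 3 * f_max\<close>,
  combined with \<open>f_max \<le> n ^ d * f_min\<close>, is divided by \<open>f_min\<close> and
  solved for the degree by logarithms.\<close>

lemma deg_bound:
  assumes inv: "inv P S \<phi>" and pb: "poly_bounded d n E f"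
  shows "real (deg S v) \<le> 3 + real d * (ln (real n + 2) / ln C)"
proof (cases "deg S v = 0")
  case False
  then have *: "\<phi> v \<le> f_max E f" "nonzero_marginals E f \<noteq> {}" "0 < f_min E f"
      "C ^ deg S v * f_min E f \<le> C ^ 3 * \<phi> v"
    using inv unfolding inv_def by auto
  then have "f_max E f \<le> real n ^ d * f_min E f"
    using pb unfolding poly_bounded_def by (simp add: pos_divide_le_eq)
  \<comment> \<open>The shift to \<open>n + 2\<close> keeps the logarithm positive for small
    \<open>n\<close>.\<close>
  also have "\<dots> \<le> (real n + 2) ^ d * f_min E f"
    using * by (intro mult_right_mono power_mono) auto
  finally have "C ^ 3 * \<phi> v \<le> C ^ 3 * ((real n + 2) ^ d * f_min E f)"
    using * by (intro mult_left_mono) auto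
  with *(4) have "C ^ deg S v * f_min E f \<le> (C ^ 3 * (real n + 2) ^ d) * f_min E f"
    unfolding mult.assoc by (rule order.trans)
  then have "C ^ deg S v \<le> C ^ 3 * (real n + 2) ^ d"
    using * by (simp add: mult_le_cancel_right)
  then have "ln (C ^ deg S v) \<le> ln (C ^ 3 * (real n + 2) ^ d)"
    by (subst ln_le_cancel_iff) (auto intro!: mult_pos_pos)
  also have "\<dots> = 3 * ln C + real d * ln (real n + 2)"
    by (subst ln_mult_pos) (auto simp: ln_realpow)
  finally have "real (deg S v) * ln C \<le> 3 * ln C + real d * ln (real n + 2)"
    by (simp add: ln_realpow)
  moreover have "0 < ln C" using C_gt_1 by simp
  ultimately show ?thesis by (simp add: field_simps)
qed (use C_gt_1 in simp)

text \<open>The greedy matching covers all edges of the stack by at most \<open>2 * M_max E\<close>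
  vertices, each of logarithmic degree.\<close>

lemma length_stack_le:
  assumes inv: "inv P S \<phi>" and pb: "poly_bounded d n E f"
  shows "real (length S) \<le> 2 * real (M_max E) * (3 + real d * (ln (real n + 2) / ln C))"
proof -
  let ?M = "greedy {} (rev S)" and ?b = "3 + real d * (ln (real n + 2) / ln C)"
  have M: "matching E ?M" by (rule matching_greedy[OF inv])
  then have fin: "finite ?M" using finite_E finite_subset unfolding matching_def by auto
  have e: "finite e" "card e = 2" if "e \<in> ?M" for e
    using that M graph unfolding matching_def graph_def by (auto intro: finite_subset)
  have "finite {M. matching E M}"
    using finite_E by (rule_tac finite_subset[of _ "Pow E"]) (auto simp: matching_def)
  then have "card ?M \<le> M_max E" using M unfolding M_max_def by auto
  moreover have "card (\<Union>?M) \<le> 2 * card ?M"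
    using card_Union_le_sum_card[of ?M] e by (simp add: mult.commute)
  ultimately have c: "real (card (\<Union>?M)) \<le> 2 * real (M_max E)" by simp
  have "length S \<le> (\<Sum>v\<in>\<Union>?M. deg S v)"
    using fin e greedy_maximal[of _ _ "rev S" "{}"] by (intro length_le_sum_deg) auto
  then have "real (length S) \<le> (\<Sum>v\<in>\<Union>?M. real (deg S v))"
    by (metis of_nat_le_iff of_nat_sum)
  also have "\<dots> \<le> real (card (\<Union>?M)) * ?b"
    by (rule sum_bounded_above) (rule deg_bound[OF inv pb])
  also have "\<dots> \<le> 2 * real (M_max E) * ?b"
    using c C_gt_1 by (intro mult_right_mono) (auto intro!: add_nonneg_nonneg)
  finally show ?thesis .
qed

end

section \<open>Reasoning about programs\<close>

text \<open>A weakest precondition with a time budget \<open>T\<close>. Programs are verified by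
  executing them symbolically, with one such goal for each remaining piece of code.\<close>

definition reaches ::
  "(edge set \<Rightarrow> real) \<Rightarrow> edge set \<Rightarrow> nat \<Rightarrow> real \<Rightarrow> com \<Rightarrow> memory \<Rightarrow> nat \<Rightarrow> (memory \<Rightarrow> bool) \<Rightarrow> bool"
where
  "reaches f A N F c s T Q \<longleftrightarrow>
     (\<exists>tr s'. exec f A c s tr s' \<and> length tr \<le> T \<and> (\<forall>m\<in>set tr. fits_words N F m) \<and>
        fits_words N F s' \<and> Q s')"

lemma fits_words_ints:
  "fits_words N F s \<Longrightarrow> a \<le> N \<Longrightarrow> x \<le> N \<Longrightarrow> fits_words N F (s\<lparr>ints := (ints s)(a := x)\<rparr>)"
  by (simp add: fits_words_def)

text \<open>Blank cells carry no bound. The alternative \<open>x = 0\<close> is separate because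
  \<open>F\<close> is arbitrary and \<open>real N * F\<close> may be negative.\<close>

lemma fits_words_reals:
  "fits_words N F s \<Longrightarrow> a \<le> N \<Longrightarrow> \<bar>x\<bar> \<le> real N * F \<or> x = 0 \<Longrightarrow>
    fits_words N F (s\<lparr>reals := (reals s)(a := x)\<rparr>)"
  by (auto simp: fits_words_def)

lemma reaches_Skip:
  "fits_words N F s \<Longrightarrow> Q s \<Longrightarrow> 1 \<le> T \<Longrightarrow> reaches f A N F Skip s T Q"
  unfolding reaches_def by (intro exI[of _ "[s]"] exI[of _ s]) (auto intro: exec.intros)

lemma reaches_IStore:
  assumes "fits_words N F s" "ival a s = x" "ival e s = y" "x \<le> N" "y \<le> N"
    and "s' = s\<lparr>ints := (ints s)(x := y)\<rparr>" and "fits_words N F s' \<Longrightarrow> Q s'"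
  shows "reaches f A N F (IStore a e) s 1 Q"
  unfolding reaches_def
  using fits_words_ints[OF assms(1,4,5)] assms(2,3,6,7) exec.IStore[OF refl, of f A a e s] by force

lemma reaches_RStore:
  assumes "fits_words N F s" "ival a s = x" "rval e s = y" "x \<le> N" "\<bar>y\<bar> \<le> real N * F \<or> y = 0"
    and "s' = s\<lparr>reals := (reals s)(x := y)\<rparr>" and "fits_words N F s' \<Longrightarrow> Q s'"
  shows "reaches f A N F (RStore a e) s 1 Q"
  unfolding reaches_def
  using fits_words_reals[OF assms(1,4,5)] assms(2,3,6,7) exec.RStore[OF refl, of f A a e s] by force

lemma reaches_Query:
  assumes "fits_words N F s" "ival a s = x" "stored_edges s (ival b s) (ival k s) = X"
    and "x \<le> N" "\<bar>f X\<bar> \<le> real N * F \<or> f X = 0" "X \<subseteq> A"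
    and "s' = s\<lparr>reals := (reals s)(x := f X)\<rparr>" and "fits_words N F s' \<Longrightarrow> Q s'"
  shows "reaches f A N F (Query a b k) s 1 Q"
  unfolding reaches_def
  using fits_words_reals[OF assms(1,4,5)] assms(2,7,8)
    exec.Query[OF assms(3)[symmetric] assms(6) refl, of f a] by force

text \<open>The rest of the program becomes the postcondition of its first command, so the memory
  between them need not be named in advance.\<close>

lemma reaches_Seq:
  assumes "reaches f A N F c1 s T1 (\<lambda>s1. fits_words N F s1 \<longrightarrow> reaches f A N F c2 s1 T2 Q)"
    and "T1 + T2 \<le> T"
  shows "reaches f A N F (Seq c1 c2) s T Q"
proof -
  obtain tr1 s1 where 1: "exec f A c1 s tr1 s1" "length tr1 \<le> T1" "\<forall>m\<in>set tr1. fits_words N F m"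
      "reaches f A N F c2 s1 T2 Q"
    using assms(1) unfolding reaches_def by blast
  obtain tr2 s2 where 2: "exec f A c2 s1 tr2 s2" "length tr2 \<le> T2" "\<forall>m\<in>set tr2. fits_words N F m"
      "fits_words N F s2" "Q s2"
    using 1(4) unfolding reaches_def by blast
  have "exec f A (Seq c1 c2) s (tr1 @ tr2) s2" using 1 2 by (auto intro: exec.Seq)
  moreover have "length (tr1 @ tr2) \<le> T" using 1 2 assms(2) by simp
  moreover have "\<forall>m\<in>set (tr1 @ tr2). fits_words N F m" using 1 2 by auto
  ultimately show ?thesis using 2 unfolding reaches_def by blast
qed

text \<open>Address and value are first evaluated to \<open>x\<close> and \<open>y\<close>, so that
  every intermediate memory is a single explicit update of the previous one.\<close>

lemma reaches_Seq_IStore: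
  assumes "fits_words N F s" "ival a s = x" "ival e s = y" "x \<le> N" "y \<le> N"
    and "s' = s\<lparr>ints := (ints s)(x := y)\<rparr>" and "fits_words N F s' \<Longrightarrow> reaches f A N F c s' T Q"
    and "1 + T \<le> T'"
  shows "reaches f A N F (Seq (IStore a e) c) s T' Q"
  by (rule reaches_Seq[OF reaches_IStore[OF assms(1-6)] assms(8)]) (use assms(7) in blast)

lemma reaches_Seq_RStore:
  assumes "fits_words N F s" "ival a s = x" "rval e s = y" "x \<le> N" "\<bar>y\<bar> \<le> real N * F \<or> y = 0"
    and "s' = s\<lparr>reals := (reals s)(x := y)\<rparr>" and "fits_words N F s' \<Longrightarrow> reaches f A N F c s' T Q"
    and "1 + T \<le> T'"
  shows "reaches f A N F (Seq (RStore a e) c) s T' Q"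
  by (rule reaches_Seq[OF reaches_RStore[OF assms(1-6)] assms(8)]) (use assms(7) in blast)

lemma reaches_Seq_Query:
  assumes "fits_words N F s" "ival a s = x" "stored_edges s (ival b s) (ival k s) = X"
    and "x \<le> N" "\<bar>f X\<bar> \<le> real N * F \<or> f X = 0" "X \<subseteq> A"
    and "s' = s\<lparr>reals := (reals s)(x := f X)\<rparr>" and "fits_words N F s' \<Longrightarrow> reaches f A N F c s' T Q"
    and "1 + T \<le> T'"
  shows "reaches f A N F (Seq (Query a b k) c) s T' Q"
  by (rule reaches_Seq[OF reaches_Query[where f = f, OF assms(1-7)] assms(9)]) (use assms(8) in blast)

lemma reaches_Cond:
  assumes "fits_words N F s"
    and "bval b s \<Longrightarrow> reaches f A N F c1 s T Q" and "\<not> bval b s \<Longrightarrow> reaches f A N F c2 s T Q"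
    and "T + 1 \<le> T'"
  shows "reaches f A N F (Cond b c1 c2) s T' Q"
proof (cases "bval b s")
  case True
  then obtain tr s' where *: "exec f A c1 s tr s'" "length tr \<le> T" "\<forall>m\<in>set tr. fits_words N F m"
      "fits_words N F s'" "Q s'"
    using assms(2) unfolding reaches_def by blast
  have "exec f A (Cond b c1 c2) s (s # tr) s'" using True *(1) by (rule exec.CondTrue)
  then show ?thesis using * assms(1,4) unfolding reaches_def by force
next
  case False
  then obtain tr s' where *: "exec f A c2 s tr s'" "length tr \<le> T" "\<forall>m\<in>set tr. fits_words N F m"
      "fits_words N F s'" "Q s'"
    using assms(3) unfolding reaches_def by blast
  have "exec f A (Cond b c1 c2) s (s # tr) s'" using False *(1) by (rule exec.CondFalse)
  then show ?thesis using * assms(1,4) unfolding reaches_def by force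
qed

lemma reaches_WhileFalse:
  "fits_words N F s \<Longrightarrow> \<not> bval b s \<Longrightarrow> Q s \<Longrightarrow> 1 \<le> T \<Longrightarrow> reaches f A N F (While b c) s T Q"
  unfolding reaches_def by (intro exI[of _ "[s]"] exI[of _ s]) (auto intro: exec.intros)

lemma reaches_WhileTrue:
  assumes "fits_words N F s" "bval b s"
    and "reaches f A N F c s T1 (\<lambda>s1. fits_words N F s1 \<longrightarrow> reaches f A N F (While b c) s1 T2 Q)"
    and "1 + T1 + T2 \<le> T"
  shows "reaches f A N F (While b c) s T Q"
proof -
  obtain tr1 s1 where 1: "exec f A c s tr1 s1" "length tr1 \<le> T1" "\<forall>m\<in>set tr1. fits_words N F m"
      "reaches f A N F (While b c) s1 T2 Q"
    using assms(3) unfolding reaches_def by blast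
  obtain tr2 s2 where 2: "exec f A (While b c) s1 tr2 s2" "length tr2 \<le> T2"
      "\<forall>m\<in>set tr2. fits_words N F m" "fits_words N F s2" "Q s2"
    using 1(4) unfolding reaches_def by blast
  have "exec f A (While b c) s (s # tr1 @ tr2) s2"
    using assms(2) 1 2 by (auto intro: exec.WhileTrue)
  moreover have "length (s # tr1 @ tr2) \<le> T" using 1 2 assms(4) by simp
  moreover have "\<forall>m\<in>set (s # tr1 @ tr2). fits_words N F m" using 1 2 assms(1) by auto
  ultimately show ?thesis using 2 unfolding reaches_def by blast
qed

section \<open>Space along an execution\<close>

text \<open>The cardinality of an infinite set is 0 by convention, so bounds on \<open>space\<close>
  propagate through updates only along with finiteness.\<close>

definition finite_memory :: "memory \<Rightarrow> bool" where
  "finite_memory s \<longleftrightarrow> finite {a. ints s a \<noteq> 0} \<and> finite {a. reals s a \<noteq> 0}"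

lemma fits_words_finite:
  assumes "fits_words N F s"
  shows "finite_memory s"
proof -
  have "{a. ints s a \<noteq> 0} \<subseteq> {..N}" "{a. reals s a \<noteq> 0} \<subseteq> {..N}"
    using assms by (auto simp: fits_words_def)
  then show ?thesis unfolding finite_memory_def using finite_atMost finite_subset by blast
qed

lemma support_fun_upd:
  assumes "finite {a. g a \<noteq> 0}"
  shows "finite {a. (g(x := y)) a \<noteq> 0} \<and> card {a. (g(x := y)) a \<noteq> 0} \<le> Suc (card {a. g a \<noteq> 0})"
proof -
  have *: "{a. (g(x := y)) a \<noteq> 0} \<subseteq> insert x {a. g a \<noteq> 0}" by auto
  then have "card {a. (g(x := y)) a \<noteq> 0} \<le> card (insert x {a. g a \<noteq> 0})"
    using assms by (intro card_mono) auto
  also have "\<dots> \<le> Suc (card {a. g a \<noteq> 0})" by (rule card_insert_le_m1) auto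
  finally show ?thesis using * assms finite_subset by blast
qed

lemma space_ints_upd:
  assumes "finite_memory s"
  shows "finite_memory (s\<lparr>ints := (ints s)(x := y)\<rparr>) \<and>
    space (s\<lparr>ints := (ints s)(x := y)\<rparr>) \<le> Suc (space s)"
  using assms support_fun_upd[of "ints s" x y] by (simp add: space_def finite_memory_def)

lemma space_reals_upd:
  assumes "finite_memory s"
  shows "finite_memory (s\<lparr>reals := (reals s)(x := y)\<rparr>) \<and>
    space (s\<lparr>reals := (reals s)(x := y)\<rparr>) \<le> Suc (space s)"
  using assms support_fun_upd[of "reals s" x y] by (simp add: space_def finite_memory_def)

text \<open>Every step writes at most one cell, so space grows at most as fast as time.\<close>

lemma exec_space:
  assumes "exec f A c s tr s'" "finite_memory s"
  shows "(\<forall>m\<in>set tr. space m \<le> space s + length tr) \<and> finite_memory s' \<and>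
    space s' \<le> space s + length tr"
  using assms
proof (induction rule: exec.induct)
  case (IStore s' s a e)
  then show ?case using space_ints_upd[of s "ival a s" "ival e s"] by simp
next
  case (RStore s' s a e)
  then show ?case using space_reals_upd[of s "ival a s" "rval e s"] by simp
next
  case (Query X s b k s' a)
  then show ?case using space_reals_upd[of s "ival a s" "f X"] by simp
qed fastforce+

section \<open>The streaming algorithm\<close>

text \<open>
  Integer cell \<open>3\<close> holds the size of the stack, whose \<open>i\<close>-th edge is in the cells \<open>4 + 2 * i\<close> and
  \<open>5 + 2 * i\<close>. Real cells \<open>0\<close> and \<open>1\<close> hold the values of \<open>f\<close> without and with the arriving edge,
  and cell \<open>2 + v\<close> the potential of \<open>v\<close>. While the stack is emptied, vertices are marked as
  matched by resetting their potentials to \<open>0\<close>.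
\<close>

abbreviation cell :: "nat \<Rightarrow> iexp" where "cell i \<equiv> ILoad (Const i)"

definition top_addr :: "nat \<Rightarrow> iexp" where
  "top_addr i = IAdd (Const (4 + i)) (IMul (Const 2) (cell 3))"

definition pot :: "iexp \<Rightarrow> rexp" where "pot v = RLoad (IAdd (Const 2) v)"

definition gain :: rexp where "gain = RSub (RLoad (Const 1)) (RLoad (Const 0))"

definition pots :: rexp where "pots = RAdd (pot (cell 0)) (pot (cell 1))"

definition excess :: rexp where "excess = RSub gain pots"

definition rzero :: rexp where "rzero = RSub (RLoad (Const 0)) (RLoad (Const 0))"

definition push_test :: bexp where
  "push_test = BAnd (RProdLess rzero rzero excess gain)
     (RProdLess pots pots (RAdd excess excess) excess)"

definition push_cmd :: com where
  "push_cmd = Seq (RStore (Const 1) excess)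
     (Seq (RStore (IAdd (Const 2) (cell 0)) (RAdd (pot (cell 0)) (RLoad (Const 1))))
     (Seq (RStore (IAdd (Const 2) (cell 1)) (RAdd (pot (cell 1)) (RLoad (Const 1))))
     (IStore (Const 3) (IAdd (cell 3) (Const 1)))))"

definition edge_cmd :: com where
  "edge_cmd = Seq (IStore (top_addr 0) (cell 0))
     (Seq (IStore (top_addr 1) (cell 1))
     (Seq (Query (Const 0) (Const 4) (cell 3))
     (Seq (Query (Const 1) (Const 4) (IAdd (cell 3) (Const 1)))
     (Cond push_test push_cmd Skip))))"

definition out_addr :: "nat \<Rightarrow> iexp" where
  "out_addr i = IAdd (IAdd (cell 0) (Const i)) (IMul (Const 2) (cell 1))"

definition take_cmd :: com where
  "take_cmd = Seq (IStore (out_addr 0) (ILoad (top_addr 0)))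
     (Seq (IStore (out_addr 1) (ILoad (top_addr 1)))
     (Seq (IStore (Const 1) (IAdd (cell 1) (Const 1)))
     (Seq (RStore (IAdd (Const 2) (ILoad (top_addr 0))) rzero)
     (RStore (IAdd (Const 2) (ILoad (top_addr 1))) rzero))))"

definition pop_cmd :: com where
  "pop_cmd = Seq (IStore (Const 3) (ISub (cell 3) (Const 1)))
     (Cond (RProdLess rzero rzero (pot (ILoad (top_addr 0))) (pot (ILoad (top_addr 1))))
       take_cmd Skip)"

definition finish_cmd :: com where
  "finish_cmd = Seq (IStore (Const 0) (top_addr 0))
     (Seq (IStore (Const 1) (Const 0)) (While (ILess (Const 0) (cell 3)) pop_cmd))"

definition stack_alg :: stream_alg where
  "stack_alg = \<lparr>init = Skip, on_edge = edge_cmd, finish = finish_cmd\<rparr>"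

lemmas expr_defs = top_addr_def out_addr_def pot_def gain_def pots_def excess_def rzero_def

text \<open>Unlike \<open>stored_edges\<close>, this keeps the order of the edges and of their
  endpoints, on which popping depends.\<close>

definition stores :: "memory \<Rightarrow> nat \<Rightarrow> (nat \<times> nat) list \<Rightarrow> bool" where
  "stores s b S \<longleftrightarrow>
     (\<forall>i<length S. ints s (b + 2 * i) = fst (S ! i) \<and> ints s (b + 2 * i + 1) = snd (S ! i))"

lemma stored_edges_stores:
  assumes "stores s b S" "length S = k"
  shows "stored_edges s b k = edge_set S"
proof -
  have "stored_edges s b k = (\<lambda>i. (\<lambda>(u, v). {u, v}) (S ! i)) ` {..<length S}"
    unfolding stored_edges_def assms(2)[symmetric] using assms(1)
    by (intro image_cong) (auto simp: stores_def case_prod_beta)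
  also have "\<dots> = edge_set S"
    using nth_image[of "length S" S]
    by (simp add: edge_set_def stream_edges_def lessThan_atLeast0 image_image[symmetric])
  finally show ?thesis .
qed

lemma stores_Nil [simp]: "stores s b []"
  by (simp add: stores_def)

lemma stores_snoc:
  "stores s b (S @ [(u, v)]) \<longleftrightarrow>
     stores s b S \<and> ints s (b + 2 * length S) = u \<and> ints s (b + 2 * length S + 1) = v"
  by (auto simp: stores_def nth_append less_Suc_eq)

lemma stores_cong:
  assumes "stores s b S" "\<And>a. b \<le> a \<Longrightarrow> a < b + 2 * length S \<Longrightarrow> ints s' a = ints s a"
  shows "stores s' b S"
  using assms by (auto simp: stores_def)

text \<open>\<open>L\<close> is the output so far, stored above the stack from address
  \<open>b\<close> on, and \<open>B\<close> the set of matched vertices, marked by potential 0. The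
  stack is consumed from its top, hence the induction from the end of the list. An iteration costs
  one step for the guard and at most 7 for the body.\<close>

lemma reaches_pop_loop:
  fixes N :: nat and F :: real
  assumes "fits_words N F s" "stores s 4 S" "ints s 3 = length S"
    and "ints s 0 = b" "4 + 2 * length S \<le> b"
    and "ints s 1 = length L" "stores s b L" "b + 2 * length L + 2 * length S \<le> N"
    and "\<And>z. z \<in> B \<Longrightarrow> reals s (2 + z) = 0"
    and "\<And>z u v. (u, v) \<in> set S \<Longrightarrow> z \<in> {u, v} \<Longrightarrow> z \<notin> B \<Longrightarrow> 0 < reals s (2 + z)"
    and "\<And>u v. (u, v) \<in> set S \<Longrightarrow> u + 2 \<le> N \<and> v + 2 \<le> N"
  shows "reaches f A N F (While (ILess (Const 0) (cell 3)) pop_cmd) s (8 * length S + 1)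
    (\<lambda>s'. stored_edges s' (ints s' 0) (ints s' 1) = edge_set L \<union> greedy B (rev S))"
  using assms
proof (induction S arbitrary: s L B rule: rev_induct)
  case Nil
  then show ?case
    by (intro reaches_WhileFalse) (auto simp: stored_edges_stores)
next
  case (snoc x S)
  obtain u v where x: "x = (u, v)" by fastforce
  let ?l = "length S"
  define s1 where "s1 = s\<lparr>ints := (ints s)(3 := ?l)\<rparr>"
  have st: "stores s 4 S" "ints s (4 + 2 * ?l) = u" "ints s (5 + 2 * ?l) = v"
    using snoc.prems(2) by (auto simp: x stores_snoc)
  have st1: "stores s1 4 S" "stores s1 b L"
    using st(1) snoc.prems(5,7) by (auto elim!: stores_cong simp: s1_def)
  have uv: "u + 2 \<le> N" "v + 2 \<le> N" using snoc.prems(11)[of u v] by (auto simp: x)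
  \<comment> \<open>Once cell 3 is decremented, \<open>top_addr\<close> points to the popped edge,
    which is still in memory.\<close>
  have addr: "ival (top_addr 0) s1 = 4 + 2 * ?l" "ival (top_addr 1) s1 = 5 + 2 * ?l"
    by (auto simp: expr_defs s1_def)
  have val: "ints s1 (4 + 2 * ?l) = u" "ints s1 (5 + 2 * ?l) = v" "ints s1 3 = ?l"
      "ints s1 0 = b" "ints s1 1 = length L" "reals s1 = reals s"
    using st snoc.prems by (auto simp: s1_def)
  \<comment> \<open>One product tests both endpoints, since a potential here is 0 if the vertex is
    matched and positive otherwise.\<close>
  have free: "0 < reals s (2 + u) * reals s (2 + v) \<longleftrightarrow> u \<notin> B \<and> v \<notin> B"
    using snoc.prems(9)[of u] snoc.prems(9)[of v]
      snoc.prems(10)[of u v u] snoc.prems(10)[of u v v] by (auto simp: x)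
  show ?case
  proof (rule reaches_WhileTrue[where ?T1.0 = 7 and ?T2.0 = "8 * ?l + 1"])
    show "fits_words N F s" by (rule snoc.prems)
    show "bval (ILess (Const 0) (cell 3)) s" using snoc.prems(3) by simp
    show "1 + 7 + (8 * ?l + 1) \<le> 8 * length (S @ [x]) + 1" by simp
    let ?Q = "\<lambda>s1. fits_words N F s1 \<longrightarrow>
      reaches f A N F (While (ILess (Const 0) (cell 3)) pop_cmd) s1 (8 * ?l + 1)
        (\<lambda>s'. stored_edges s' (ints s' 0) (ints s' 1) = edge_set L \<union> greedy B (rev (S @ [x])))"
    have "reaches f A N F (Cond (RProdLess rzero rzero (pot (ILoad (top_addr 0)))
       (pot (ILoad (top_addr 1)))) take_cmd Skip) s1 6 ?Q" if fits: "fits_words N F s1"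
    proof (rule reaches_Cond[OF fits, where T = 5])
      assume "bval (RProdLess rzero rzero (pot (ILoad (top_addr 0))) (pot (ILoad (top_addr 1)))) s1"
      then have nB: "u \<notin> B" "v \<notin> B"
        using free val addr by (auto simp: rzero_def pot_def)
      define s2 where "s2 = s1\<lparr>ints := (ints s1)(b + 2 * length L := u)\<rparr>"
      define s3 where "s3 = s2\<lparr>ints := (ints s2)(b + 1 + 2 * length L := v)\<rparr>"
      define s4 where "s4 = s3\<lparr>ints := (ints s3)(1 := length L + 1)\<rparr>"
      define s5 where "s5 = s4\<lparr>reals := (reals s4)(2 + u := 0)\<rparr>"
      define s6 where "s6 = s5\<lparr>reals := (reals s5)(2 + v := 0)\<rparr>"
      note defs = s6_def s5_def s4_def s3_def s2_def
      have b: "4 + 2 * length S + 2 \<le> b" using snoc.prems(5) by simp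
      have Q: "?Q s6"
      proof
        assume "fits_words N F s6"
        have "reaches f A N F (While (ILess (Const 0) (cell 3)) pop_cmd) s6 (8 * ?l + 1)
          (\<lambda>s'. stored_edges s' (ints s' 0) (ints s' 1) =
            edge_set (L @ [(u, v)]) \<union> greedy (B \<union> {u, v}) (rev S))"
        proof (rule snoc.IH)
          show "fits_words N F s6" by fact
          show "stores s6 4 S"
            using st1(1) b by (auto elim!: stores_cong simp: defs)
          have "stores s6 b L"
            using st1(2) b by (auto elim!: stores_cong simp: defs)
          then show "stores s6 b (L @ [(u, v)])"
            using b by (auto simp: stores_snoc defs)
          show "0 < reals s6 (2 + z)" if "(a, c) \<in> set S" "z \<in> {a, c}" "z \<notin> B \<union> {u, v}" for z a c
            using snoc.prems(10)[of a c z] that val by (auto simp: defs)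
          show "reals s6 (2 + z) = 0" if "z \<in> B \<union> {u, v}" for z
            using snoc.prems(9)[of z] that val by (auto simp: defs)
          show "a + 2 \<le> N \<and> c + 2 \<le> N" if "(a, c) \<in> set S" for a c
            using snoc.prems(11)[of a c] that by simp
        qed (use snoc.prems(8) b val in \<open>auto simp: defs\<close>)
        then show "reaches f A N F (While (ILess (Const 0) (cell 3)) pop_cmd) s6 (8 * ?l + 1)
          (\<lambda>s'. stored_edges s' (ints s' 0) (ints s' 1) = edge_set L \<union> greedy B (rev (S @ [x])))"
          using nB by (simp add: x)
      qed
      have N: "b + 2 * length L + 2 \<le> N" using snoc.prems(8) by simp
      have out: "ival (out_addr 0) s1 = b + 2 * length L" "ival (out_addr 1) s2 = b + 1 + 2 * length L"
        using b val by (auto simp: expr_defs s2_def)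
      have v2: "ival (ILoad (top_addr 0)) s1 = u" using addr val by simp
      have v3: "ival (ILoad (top_addr 1)) s2 = v"
        using b st by (auto simp: s2_def expr_defs s1_def)
      have v4: "ival (IAdd (Const 2) (ILoad (top_addr 0))) s4 = 2 + u"
        using b st by (auto simp: s4_def s3_def s2_def expr_defs s1_def)
      have v5: "ival (IAdd (Const 2) (ILoad (top_addr 1))) s5 = 2 + v"
        using b st by (auto simp: s5_def s4_def s3_def s2_def expr_defs s1_def)
      have v6: "ival (IAdd (cell 1) (Const 1)) s3 = length L + 1"
        using b val by (auto simp: s3_def s2_def)
      have z: "rval rzero m = 0" for m by (simp add: rzero_def)
      have 5: "reaches f A N F (RStore (IAdd (Const 2) (ILoad (top_addr 1))) rzero) s5 1 ?Q"
        if "fits_words N F s5"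
        using uv Q by (intro reaches_RStore[OF that v5 z _ _ s6_def]) auto
      have 4: "reaches f A N F (Seq (RStore (IAdd (Const 2) (ILoad (top_addr 0))) rzero)
          (RStore (IAdd (Const 2) (ILoad (top_addr 1))) rzero)) s4 2 ?Q" if "fits_words N F s4"
        by (rule reaches_Seq_RStore[OF that v4 z _ _ s5_def 5]) (use uv in auto)
      have 3: "reaches f A N F (Seq (IStore (Const 1) (IAdd (cell 1) (Const 1)))
          (Seq (RStore (IAdd (Const 2) (ILoad (top_addr 0))) rzero)
          (RStore (IAdd (Const 2) (ILoad (top_addr 1))) rzero))) s3 3 ?Q" if "fits_words N F s3"
        by (rule reaches_Seq_IStore[OF that _ v6 _ _ s4_def 4]) (use N in auto)
      have 2: "reaches f A N F (Seq (IStore (out_addr 1) (ILoad (top_addr 1)))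
          (Seq (IStore (Const 1) (IAdd (cell 1) (Const 1)))
          (Seq (RStore (IAdd (Const 2) (ILoad (top_addr 0))) rzero)
          (RStore (IAdd (Const 2) (ILoad (top_addr 1))) rzero)))) s2 4 ?Q" if "fits_words N F s2"
        by (rule reaches_Seq_IStore[OF that out(2) v3 _ _ s3_def 3]) (use N uv in auto)
      show "reaches f A N F take_cmd s1 5 ?Q"
        unfolding take_cmd_def
        by (rule reaches_Seq_IStore[OF fits out(1) v2 _ _ s2_def 2]) (use N uv in auto)
    next
      assume "\<not> bval (RProdLess rzero rzero (pot (ILoad (top_addr 0))) (pot (ILoad (top_addr 1)))) s1"
      then have "u \<in> B \<or> v \<in> B"
        using free val addr by (auto simp: rzero_def pot_def)
      moreover have "reaches f A N F (While (ILess (Const 0) (cell 3)) pop_cmd) s1 (8 * ?l + 1)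
          (\<lambda>s'. stored_edges s' (ints s' 0) (ints s' 1) = edge_set L \<union> greedy B (rev S))"
      proof (rule snoc.IH[OF fits st1(1) val(3,4) _ val(5) st1(2)])
        show "0 < reals s1 (2 + z)" if "(a, c) \<in> set S" "z \<in> {a, c}" "z \<notin> B" for z a c
          using snoc.prems(10)[of a c z] that val by auto
        show "reals s1 (2 + z) = 0" if "z \<in> B" for z
          using snoc.prems(9)[of z] that val by auto
        show "a + 2 \<le> N \<and> c + 2 \<le> N" if "(a, c) \<in> set S" for a c
          using snoc.prems(11)[of a c] that by simp
      qed (use snoc.prems(5,8) in auto)
      ultimately have "?Q s1" by (auto simp: x)
      then show "reaches f A N F Skip s1 5 ?Q"
        using fits by (intro reaches_Skip) auto
    qed simp
    moreover have "reaches f A N F pop_cmd s 7 Q"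
      if "fits_words N F s1 \<Longrightarrow> reaches f A N F (Cond (RProdLess rzero rzero
        (pot (ILoad (top_addr 0))) (pot (ILoad (top_addr 1)))) take_cmd Skip) s1 6 Q" for Q
      unfolding pop_cmd_def
      by (rule reaches_Seq_IStore[OF snoc.prems(1) _ _ _ _ s1_def that])
        (use snoc.prems(3,5,8) uv in auto)
    ultimately show "reaches f A N F pop_cmd s 7 ?Q" by blast
  qed
qed

section \<open>Arrival of an edge and emptying of the stack\<close>

text \<open>Blankness starts only at \<open>6 + 2 * length S\<close>, because the two cells above
  the stack may still hold a rejected edge. Real cells 0 and 1 are scratch and left
  unspecified.\<close>

definition represents :: "memory \<Rightarrow> (nat \<times> nat) list \<Rightarrow> (nat \<Rightarrow> real) \<Rightarrow> bool" where
  "represents s S \<phi> \<longleftrightarrow> stores s 4 S \<and> ints s 3 = length S \<and>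
     (\<forall>a\<ge>6 + 2 * length S. ints s a = 0) \<and> (\<forall>v. reals s (2 + v) = \<phi> v)"

lemma deg_eq_0_iff: "deg S v = 0 \<longleftrightarrow> v \<notin> \<Union>(edge_set S)"
  by (induction S) (auto split: if_splits)

lemma card_Union_edge_set:
  "finite (\<Union>(edge_set S)) \<and> card (\<Union>(edge_set S)) \<le> 2 * length S"
proof (induction S)
  case (Cons x S)
  obtain u v where x: "x = (u, v)" by fastforce
  have "card ({u, v} \<union> \<Union>(edge_set S)) \<le> card {u, v} + card (\<Union>(edge_set S))"
    by (rule card_Un_le)
  also have "card {u, v} \<le> 2" by (simp add: card_insert_if)
  finally show ?case using Cons by (simp add: x)
qed simp

context msm
begin

text \<open>Apart from the two scratch cells, nonzero reals are potentials of endpoints of stack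
  edges, at most \<open>2 * length S\<close> many. Integers contribute at most
  \<open>6 + 2 * length S\<close> cells.\<close>

lemma represents_space:
  assumes inv: "inv P S \<phi>" and rep: "represents s S \<phi>"
  shows "space s \<le> 8 + 4 * length S"
proof -
  have "{a. ints s a \<noteq> 0} \<subseteq> {..<6 + 2 * length S}"
    using rep unfolding represents_def by (metis (mono_tags, lifting) lessThan_iff mem_Collect_eq not_le subsetI)
  then have 1: "card {a. ints s a \<noteq> 0} \<le> 6 + 2 * length S"
    using card_mono[of "{..<6 + 2 * length S}"] by simp
  let ?V = "\<Union>(edge_set S)"
  have "{a. reals s a \<noteq> 0} \<subseteq> {0, 1} \<union> (+) 2 ` ?V"
  proof
    fix a assume a: "a \<in> {a. reals s a \<noteq> 0}"
    show "a \<in> {0, 1} \<union> (+) 2 ` ?V"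
    proof (cases "2 \<le> a")
      case True
      then obtain v where v: "a = 2 + v" using le_Suc_ex by blast
      then have "deg S v \<noteq> 0" using a inv rep unfolding represents_def inv_def by auto
      then have "v \<in> ?V" using deg_eq_0_iff[of S v] by simp
      then show ?thesis using v by blast
    qed auto
  qed
  then have "card {a. reals s a \<noteq> 0} \<le> card ({0, 1} \<union> (+) 2 ` ?V)"
    using card_Union_edge_set[of S] by (intro card_mono) auto
  also have "\<dots> \<le> card {0, 1 :: nat} + card ((+) 2 ` ?V)" by (rule card_Un_le)
  also have "\<dots> \<le> 2 + 2 * length S"
    using card_Union_edge_set[of S] card_image_le[of ?V "(+) 2"] by auto
  finally show ?thesis using 1 by (simp add: space_def)
qed

text \<open>The edge is written just above the stack before the test, so both queries read the same
  region, with sizes \<open>length S\<close> and \<open>length S + 1\<close>. Accepting the edge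
  then only takes incrementing the size and updating the potentials.\<close>

lemma edge_step:
  assumes inv: "inv P S \<phi>" and rep: "represents s S \<phi>" and fits: "fits_words N (f_max E f) s"
    and e: "{u, v} \<in> E" "{u, v} \<notin> P" and N: "n + 2 \<le> N" "16 + 4 * card E \<le> N"
  shows "reaches f (insert {u, v} P) N (f_max E f) edge_cmd (receive u v s) 9
    (\<lambda>s'. \<exists>S' \<phi>'. inv (insert {u, v} P) S' \<phi>' \<and> represents s' S' \<phi>')"
    (is "reaches _ ?A _ ?F _ _ _ ?Q")
proof -
  note uv = edgeD[OF e(1)]
  let ?l = "length S" and ?S = "edge_set S"
  have SP: "?S \<subseteq> P" "P \<subseteq> E" and SE: "?S \<subseteq> E" using inv unfolding inv_def by auto
  have l: "?l \<le> card E"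
    using length_stack_le_card[OF inv] card_mono[OF finite_E SP(2)] by simp
  have F0: "0 \<le> ?F" using e by (intro f_max_nonneg) auto
  have bound: "\<bar>f X\<bar> \<le> real N * ?F \<or> f X = 0" if "X \<subseteq> E" for X
  proof -
    have "f X \<le> (real (card E) + 1) * ?F" using e that by (intro f_le) auto
    also have "\<dots> \<le> real N * ?F" using N F0 by (intro mult_right_mono) auto
    finally show ?thesis using nonneg that by (simp add: nonneg_on_def)
  qed
  have bound1: "\<bar>r\<bar> \<le> real N * ?F \<or> r = 0" if "0 \<le> r" "r \<le> ?F" for r
  proof -
    have "1 * ?F \<le> real N * ?F" using N F0 by (intro mult_right_mono) auto
    then show ?thesis using that by simp
  qed
  have st: "stores s 4 S" "ints s 3 = ?l" "\<And>z. reals s (2 + z) = \<phi> z"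
      "\<And>a. a \<ge> 6 + 2 * ?l \<Longrightarrow> ints s a = 0"
    using rep unfolding represents_def by auto
  define s0 where "s0 = receive u v s"
  define s1 where "s1 = s0\<lparr>ints := (ints s0)(4 + 2 * ?l := u)\<rparr>"
  define s2 where "s2 = s1\<lparr>ints := (ints s1)(5 + 2 * ?l := v)\<rparr>"
  define s3 where "s3 = s2\<lparr>reals := (reals s2)(0 := f ?S)\<rparr>"
  define s4 where "s4 = s3\<lparr>reals := (reals s3)(1 := f (insert {u, v} ?S))\<rparr>"
  have i2: "ints s2 0 = u" "ints s2 1 = v" "ints s2 3 = ?l"
      "\<And>a. a \<ge> 6 + 2 * ?l \<Longrightarrow> ints s2 a = 0"
    using st by (auto simp: s2_def s1_def s0_def receive_def)
  have r2: "reals s2 = reals s" by (auto simp: s2_def s1_def s0_def receive_def)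
  have s2S: "stores s2 4 (S @ [(u, v)])"
    using st(1) by (auto elim!: stores_cong simp: stores_snoc s2_def s1_def s0_def receive_def)
  have i4: "ints s4 = ints s2" by (simp add: s4_def s3_def)
  have r4: "reals s4 (Suc 0) = f (insert {u, v} ?S)" "reals s4 0 = f ?S"
      "\<And>z. reals s4 (Suc (Suc z)) = \<phi> z"
    using st(3) r2 by (auto simp: s4_def s3_def)
  define x where "x = f (insert {u, v} ?S) - f ?S"
  define w where "w = x - (\<phi> u + \<phi> v)"
  have x0: "0 \<le> x" using f_mono[of ?S "insert {u, v} ?S"] SE e by (auto simp: x_def)
  have \<phi>0: "0 \<le> \<phi> z" for z using inv_nonneg[OF inv] .
  have test: "bval push_test s4 \<longleftrightarrow> C * (\<phi> u + \<phi> v) < x"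
    using x0 \<phi>0[of u] \<phi>0[of v] i2 i4 r4
    by (simp add: C_test push_test_def expr_defs x_def)
  have cond: "reaches f ?A N ?F (Cond push_test push_cmd Skip) s4 5 ?Q"
    if fits: "fits_words N ?F s4"
  proof (rule reaches_Cond[OF fits, where T = 4])
    assume "bval push_test s4"
    then have push: "C * (\<phi> u + \<phi> v) < x" using test by simp
    let ?\<phi> = "\<phi>(u := \<phi> u + w, v := \<phi> v + w)"
    have inv': "inv ?A (S @ [(u, v)]) ?\<phi>"
      by (rule inv_push[OF inv e x_def w_def push])
    \<comment> \<open>The weight is saved in real cell 1 first, since \<open>excess\<close> changes
      its value as soon as one potential is updated.\<close>
    define s5 where "s5 = s4\<lparr>reals := (reals s4)(1 := w)\<rparr>"
    define s6 where "s6 = s5\<lparr>reals := (reals s5)(2 + u := \<phi> u + w)\<rparr>"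
    define s7 where "s7 = s6\<lparr>reals := (reals s6)(2 + v := \<phi> v + w)\<rparr>"
    define s8 where "s8 = s7\<lparr>ints := (ints s7)(3 := ?l + 1)\<rparr>"
    note defs = s8_def s7_def s6_def s5_def
    have "stores s8 4 (S @ [(u, v)])"
      using s2S by (rule stores_cong) (auto simp: defs i4)
    then have "represents s8 (S @ [(u, v)]) ?\<phi>"
      using i2(4) r4 by (auto simp: represents_def defs i4)
    then have Q: "?Q s8" using inv' by blast
    \<comment> \<open>Both endpoints now have positive degree, so the new invariant bounds their
      potentials by \<open>f_max E f\<close>.\<close>
    have "deg (S @ [(u, v)]) u \<noteq> 0" "deg (S @ [(u, v)]) v \<noteq> 0" by auto
    then have le: "\<phi> u + w \<le> ?F" "\<phi> v + w \<le> ?F"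
      using inv' uv(3) unfolding inv_def by (metis fun_upd_apply gr0I)+
    have w0: "0 \<le> w"
    proof -
      have "1 * (\<phi> u + \<phi> v) \<le> C * (\<phi> u + \<phi> v)"
        using C_gt_1 \<phi>0[of u] \<phi>0[of v] by (intro mult_right_mono) auto
      then show ?thesis using push by (simp add: w_def)
    qed
    have b: "\<bar>w\<bar> \<le> real N * ?F \<or> w = 0" "\<bar>\<phi> u + w\<bar> \<le> real N * ?F \<or> \<phi> u + w = 0"
        "\<bar>\<phi> v + w\<bar> \<le> real N * ?F \<or> \<phi> v + w = 0"
      using le w0 \<phi>0[of u] \<phi>0[of v] by (intro bound1; linarith)+
    have v5: "rval excess s4 = w"
      using i2 i4 r4 by (simp add: expr_defs x_def w_def)
    have v6: "ival (IAdd (Const 2) (cell 0)) s5 = 2 + u"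
        "rval (RAdd (pot (cell 0)) (RLoad (Const 1))) s5 = \<phi> u + w"
      using i2 i4 r4 by (simp_all add: s5_def expr_defs)
    have v7: "ival (IAdd (Const 2) (cell 1)) s6 = 2 + v"
        "rval (RAdd (pot (cell 1)) (RLoad (Const 1))) s6 = \<phi> v + w"
      using i2 i4 r4 uv by (simp_all add: s6_def s5_def expr_defs)
    have v8: "ival (IAdd (cell 3) (Const 1)) s7 = ?l + 1"
      using i2 i4 by (simp add: s7_def s6_def s5_def)
    have 7: "reaches f ?A N ?F (IStore (Const 3) (IAdd (cell 3) (Const 1))) s7 1 ?Q"
      if "fits_words N ?F s7"
      using l N Q by (intro reaches_IStore[OF that _ v8 _ _ s8_def]) auto
    have 6: "reaches f ?A N ?F (Seq (RStore (IAdd (Const 2) (cell 1))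
        (RAdd (pot (cell 1)) (RLoad (Const 1)))) (IStore (Const 3) (IAdd (cell 3) (Const 1))))
        s6 2 ?Q" if "fits_words N ?F s6"
      by (rule reaches_Seq_RStore[OF that v7 _ b(3) s7_def 7]) (use N uv in auto)
    have 5: "reaches f ?A N ?F (Seq (RStore (IAdd (Const 2) (cell 0))
        (RAdd (pot (cell 0)) (RLoad (Const 1)))) (Seq (RStore (IAdd (Const 2) (cell 1))
        (RAdd (pot (cell 1)) (RLoad (Const 1)))) (IStore (Const 3) (IAdd (cell 3) (Const 1)))))
        s5 3 ?Q" if "fits_words N ?F s5"
      by (rule reaches_Seq_RStore[OF that v6 _ b(2) s6_def 6]) (use N uv in auto)
    show "reaches f ?A N ?F push_cmd s4 4 ?Q"
      unfolding push_cmd_def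
      by (rule reaches_Seq_RStore[OF fits _ v5 _ b(1) s5_def 5]) (use N in auto)
  next
    assume "\<not> bval push_test s4"
    then have "inv ?A S \<phi>"
      using test by (intro inv_skip[OF inv e]) (simp add: x_def)
    moreover have "represents s4 S \<phi>"
      using s2S i2 r4 by (auto simp: represents_def i4 stores_snoc elim!: stores_cong)
    ultimately have "?Q s4" by blast
    then show "reaches f ?A N ?F Skip s4 4 ?Q"
      using fits by (intro reaches_Skip) auto
  qed simp
  have s3S: "stores s3 4 (S @ [(u, v)])" using s2S by (rule stores_cong) (simp add: s3_def)
  have q3: "stored_edges s3 (ival (Const 4) s3) (ival (IAdd (cell 3) (Const 1)) s3)
      = insert {u, v} ?S"
    using stored_edges_stores[OF s3S] i2 by (simp add: s3_def)
  have "stores s2 4 S" using s2S by (simp add: stores_snoc)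
  from stored_edges_stores[OF this] have
    q2: "stored_edges s2 (ival (Const 4) s2) (ival (cell 3) s2) = ?S"
    using i2 by simp
  have 3: "reaches f ?A N ?F (Seq (Query (Const 1) (Const 4) (IAdd (cell 3) (Const 1)))
      (Cond push_test push_cmd Skip)) s3 6 ?Q" if "fits_words N ?F s3"
    by (rule reaches_Seq_Query[where f = f, OF that _ q3 _ bound _ s4_def cond])
      (use N SE SP e in auto)
  have 2: "reaches f ?A N ?F (Seq (Query (Const 0) (Const 4) (cell 3))
      (Seq (Query (Const 1) (Const 4) (IAdd (cell 3) (Const 1)))
      (Cond push_test push_cmd Skip))) s2 7 ?Q" if "fits_words N ?F s2"
    by (rule reaches_Seq_Query[where f = f, OF that _ q2 _ bound _ s3_def 3])
      (use N SE SP e in auto)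
  have 1: "reaches f ?A N ?F (Seq (IStore (top_addr 1) (cell 1))
      (Seq (Query (Const 0) (Const 4) (cell 3))
      (Seq (Query (Const 1) (Const 4) (IAdd (cell 3) (Const 1)))
      (Cond push_test push_cmd Skip)))) s1 8 ?Q" if "fits_words N ?F s1"
    by (rule reaches_Seq_IStore[OF that _ _ _ _ s2_def 2])
      (use N l uv st in \<open>auto simp: expr_defs s1_def s0_def receive_def\<close>)
  have "fits_words N ?F s0"
    using fits N uv by (auto simp: s0_def receive_def fits_words_def)
  then show ?thesis
    unfolding edge_cmd_def s0_def[symmetric]
    by (rule reaches_Seq_IStore[OF _ _ _ _ _ s1_def 1])
      (use N l uv st in \<open>auto simp: expr_defs s0_def receive_def\<close>)
qed

lemma reaches_finish:
  assumes inv: "inv P S \<phi>" and rep: "represents s S \<phi>" and fits: "fits_words N F s"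
    and N: "n + 2 \<le> N" "16 + 4 * card E \<le> N"
  shows "reaches f A N F finish_cmd s (8 * length S + 3)
    (\<lambda>s'. stored_edges s' (ints s' 0) (ints s' 1) = greedy {} (rev S))"
    (is "reaches _ _ _ _ _ _ _ ?Q")
proof -
  let ?l = "length S"
  have SP: "edge_set S \<subseteq> P" "P \<subseteq> E" using inv unfolding inv_def by auto
  have l: "?l \<le> card E"
    using length_stack_le_card[OF inv] card_mono[OF finite_E SP(2)] by simp
  have st: "stores s 4 S" "ints s 3 = ?l" "\<And>z. reals s (2 + z) = \<phi> z"
    using rep unfolding represents_def by auto
  define s1 where "s1 = s\<lparr>ints := (ints s)(0 := 4 + 2 * ?l)\<rparr>"
  define s2 where "s2 = s1\<lparr>ints := (ints s1)(1 := 0)\<rparr>"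
  have mem: "{u, v} \<in> edge_set S" if "(u, v) \<in> set S" for u v
    using that by (force simp: edge_set_def stream_edges_def)
  have 2: "reaches f A N F (While (ILess (Const 0) (cell 3)) pop_cmd) s2 (8 * ?l + 1) ?Q"
    if "fits_words N F s2"
  proof -
    have "reaches f A N F (While (ILess (Const 0) (cell 3)) pop_cmd) s2 (8 * ?l + 1)
      (\<lambda>s'. stored_edges s' (ints s' 0) (ints s' 1) = edge_set [] \<union> greedy {} (rev S))"
    \<comment> \<open>The output starts right above the stack. No vertex is matched yet, and each
      endpoint of a stack edge has positive degree, hence positive potential.\<close>
    proof (rule reaches_pop_loop[OF that, where b = "4 + 2 * ?l"])
      show "stores s2 4 S" using st(1) by (rule stores_cong) (auto simp: s2_def s1_def)
      show "0 < reals s2 (2 + z)" if "(u, v) \<in> set S" "z \<in> {u, v}" for z u v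
      proof -
        have "deg S z \<noteq> 0" using mem[OF that(1)] that(2) deg_eq_0_iff by blast
        then show ?thesis using inv st(3)[of z] unfolding inv_def by (simp add: s2_def s1_def)
      qed
      show "u + 2 \<le> N \<and> v + 2 \<le> N" if "(u, v) \<in> set S" for u v
        using edgeD[of u v] mem[OF that] SP N by auto
    qed (use st l N in \<open>auto simp: s2_def s1_def\<close>)
    then show ?thesis by simp
  qed
  have 1: "reaches f A N F (Seq (IStore (Const 1) (Const 0))
      (While (ILess (Const 0) (cell 3)) pop_cmd)) s1 (8 * ?l + 2) ?Q" if "fits_words N F s1"
    by (rule reaches_Seq_IStore[OF that _ _ _ _ s2_def 2]) (use N in auto)
  show ?thesis
    unfolding finish_cmd_def
    by (rule reaches_Seq_IStore[OF fits _ _ _ _ s1_def 1])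
      (use N l st in \<open>auto simp: expr_defs\<close>)
qed

section \<open>Runs on whole streams\<close>

text \<open>The bound \<open>K\<close> is uniform over all states satisfying \<open>inv\<close>, so
  it survives the induction unchanged. Each edge costs one step for its arrival and 9 for
  \<open>edge_cmd\<close>; these add at most 2 and 9 cells to the \<open>8 + 4 * length S\<close>
  present before.\<close>

lemma process_edges:
  assumes "inv P S \<phi>" "represents s S \<phi>" "fits_words N (f_max E f) s"
    and "distinct (stream_edges xs)" "edge_set xs \<subseteq> E" "edge_set xs \<inter> P = {}"
    and "n + 2 \<le> N" "16 + 4 * card E \<le> N"
    and "\<forall>P S \<phi>. inv P S \<phi> \<longrightarrow> 4 * length S + 20 \<le> K"
  shows "\<exists>tr s' S' \<phi>'. process f edge_cmd P xs s tr s' \<and> inv (P \<union> edge_set xs) S' \<phi>' \<and>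
    represents s' S' \<phi>' \<and> fits_words N (f_max E f) s' \<and> length tr \<le> 10 * length xs \<and>
    (\<forall>m\<in>set tr. fits_words N (f_max E f) m \<and> space m \<le> K)"
  using assms
proof (induction xs arbitrary: P S \<phi> s)
  case Nil
  have "process f edge_cmd P [] s [] s" by (rule process.Nil)
  with Nil show ?case by force
next
  case (Cons x xs)
  obtain u v where x: "x = (u, v)" by fastforce
  have e: "{u, v} \<in> E" "{u, v} \<notin> P" using Cons.prems(5,6) by (auto simp: x)
  note uv = edgeD[OF e(1)]
  let ?A = "insert {u, v} P" and ?F = "f_max E f" and ?s0 = "receive u v s"
  obtain tr1 s1 S1 \<phi>1 where 1: "exec f ?A edge_cmd ?s0 tr1 s1" "length tr1 \<le> 9"
      "\<forall>m\<in>set tr1. fits_words N ?F m" "fits_words N ?F s1" "inv ?A S1 \<phi>1" "represents s1 S1 \<phi>1"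
    using edge_step[OF Cons.prems(1-3) e Cons.prems(7,8)] unfolding reaches_def by blast
  have "distinct (stream_edges xs)" "{u, v} \<notin> edge_set xs"
    using Cons.prems(4) by (auto simp: x stream_edges_def edge_set_def)
  moreover have "edge_set xs \<subseteq> E" "edge_set xs \<inter> ?A = {}"
    using Cons.prems(5,6) calculation(2) by (auto simp: x)
  ultimately obtain tr2 s2 S2 \<phi>2 where 2: "process f edge_cmd ?A xs s1 tr2 s2"
      "inv (?A \<union> edge_set xs) S2 \<phi>2" "represents s2 S2 \<phi>2" "fits_words N ?F s2"
      "length tr2 \<le> 10 * length xs" "\<forall>m\<in>set tr2. fits_words N ?F m \<and> space m \<le> K"
    using Cons.IH[OF 1(5,6,4) _ _ _ Cons.prems(7-9)] by blast
  have "process f edge_cmd P (x # xs) s (?s0 # tr1 @ tr2) s2"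
    unfolding x by (rule process.Cons[OF refl refl 1(1) 2(1)])
  moreover have "?A \<union> edge_set xs = P \<union> edge_set (x # xs)" by (auto simp: x)
  moreover have "length (?s0 # tr1 @ tr2) \<le> 10 * length (x # xs)" using 1(2) 2(5) by simp
  moreover have "fits_words N ?F m \<and> space m \<le> K" if m: "m \<in> set (?s0 # tr1 @ tr2)" for m
  proof -
    have fits0: "fits_words N ?F ?s0"
      using Cons.prems(3,7) uv by (auto simp: receive_def fits_words_def)
    let ?s' = "s\<lparr>ints := (ints s)(0 := u)\<rparr>"
    have s': "finite_memory ?s'" "space ?s' \<le> Suc (space s)"
      using space_ints_upd[OF fits_words_finite[OF Cons.prems(3)]] by blast+
    have "?s0 = ?s'\<lparr>ints := (ints ?s')(1 := v)\<rparr>" by (simp add: receive_def)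
    then have "space ?s0 \<le> Suc (space ?s')" using space_ints_upd[OF s'(1)] by metis
    also have "\<dots> \<le> space s + 2" using s' by simp
    also have "\<dots> \<le> 4 * length S + 10" using represents_space[OF Cons.prems(1,2)] by simp
    finally have sp0: "space ?s0 + 9 \<le> K" using Cons.prems(1,9) by fastforce
    consider "m = ?s0" | "m \<in> set tr1" | "m \<in> set tr2" using m by auto
    then show ?thesis
    proof cases
      case 2
      then have "space m \<le> space ?s0 + length tr1"
        using exec_space[OF 1(1) fits_words_finite[OF fits0]] by blast
      then show ?thesis using 1(2,3) 2 sp0 by simp
    qed (use fits0 sp0 2 in auto)
  qed
  ultimately show ?case using 2(2-4) by metis
qed

text \<open>Time adds up from 10 steps per edge, 8 per stack edge, 3 more in
  \<open>finish_cmd\<close>, and two entries for the start and \<open>Skip\<close>. The 12 in the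
  space bound is 4 cells per stack edge plus the 8 steps that popping it may take.\<close>

lemma run_stack_alg:
  assumes xs: "is_stream_of E xs" and N: "n + 2 \<le> N" "16 + 4 * card E \<le> N"
    and K: "\<forall>P S \<phi>. inv P S \<phi> \<longrightarrow> 12 * length S + 20 \<le> K"
  shows "\<exists>tr M. runs stack_alg f n xs tr M \<and> length tr \<le> 18 * card E + 5 \<and>
    (\<forall>s\<in>set tr. space s \<le> K \<and> fits_words N (f_max E f) s) \<and> matching E M \<and>
    (\<forall>R. matching E R \<longrightarrow> f M \<ge> 1 / (3 + 2 * sqrt 2) * f R)"
proof -
  let ?F = "f_max E f"
  have d: "distinct (stream_edges xs)" "edge_set xs = E"
    using xs by (auto simp: is_stream_of_def edge_set_def)
  then have len: "length xs = card E"
    by (metis distinct_card edge_set_def length_map stream_edges_def)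
  have rep0: "represents (start n) [] (\<lambda>_. 0)"
    by (simp add: represents_def start_def)
  have fits0: "fits_words N ?F (start n)"
    using N by (simp add: fits_words_def start_def)
  have sp0: "space (start n) \<le> K"
    using represents_space[OF inv_init rep0] K[rule_format, OF inv_init] by simp
  have "\<exists>tr s' S' \<phi>'. process f edge_cmd {} xs (start n) tr s' \<and> inv ({} \<union> edge_set xs) S' \<phi>' \<and>
      represents s' S' \<phi>' \<and> fits_words N ?F s' \<and> length tr \<le> 10 * length xs \<and>
      (\<forall>m\<in>set tr. fits_words N ?F m \<and> space m \<le> K)"
    by (rule process_edges[OF inv_init rep0 fits0 d(1) _ _ N]) (use d K in force)+
  then obtain tr s S \<phi> where 1: "process f edge_cmd {} xs (start n) tr s" "inv E S \<phi>"
      "represents s S \<phi>" "fits_words N ?F s" "length tr \<le> 10 * card E"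
      "\<forall>m\<in>set tr. fits_words N ?F m \<and> space m \<le> K"
    using d len by auto
  let ?M = "greedy {} (rev S)"
  obtain tr' s' where 2: "exec f (set (stream_edges xs)) finish_cmd s tr' s'"
      "length tr' \<le> 8 * length S + 3" "\<forall>m\<in>set tr'. fits_words N ?F m"
      "stored_edges s' (ints s' 0) (ints s' 1) = ?M"
    using reaches_finish[OF 1(2-4) N] unfolding reaches_def by blast
  have sp: "space m \<le> K" if "m \<in> set tr'" for m
  proof -
    have "space m \<le> space s + length tr'"
      using exec_space[OF 2(1) fits_words_finite[OF 1(4)]] that by blast
    then show ?thesis using represents_space[OF 1(2,3)] K[rule_format, OF 1(2)] 2(2) by simp
  qed
  have "runs stack_alg f n xs (start n # [start n] @ tr @ tr') ?M"
    unfolding runs_def stack_alg_def using 1(1) 2(1,4) exec.Skip[of f "{}" "start n"] by fastforce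
  moreover have "length (start n # [start n] @ tr @ tr') \<le> 18 * card E + 5"
    using 1(5) 2(2) length_stack_le_card[OF 1(2)] by simp
  moreover have "\<forall>m\<in>set (start n # [start n] @ tr @ tr'). space m \<le> K \<and> fits_words N ?F m"
    using 1(6) 2(3) sp sp0 fits0 by auto
  moreover have "matching E ?M" by (rule matching_greedy[OF 1(2)])
  moreover have "\<forall>R. matching E R \<longrightarrow> f ?M \<ge> 1 / (3 + 2 * sqrt 2) * f R"
    using greedy_approx[OF 1(2)] by blast
  ultimately show ?thesis by blast
qed

end

text \<open>An affine bound in the logarithm \<open>L\<close> becomes a multiple of
  \<open>L ^ 6\<close>. Since \<open>L / ln 2 \<ge> 1\<close>, passing to its sixth power only
  increases it.\<close>

lemma ln_power_bound:
  fixes L :: real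
  assumes "ln 2 \<le> L" "0 \<le> a" "0 \<le> b"
  shows "a + b * L \<le> (a + b) / ln 2 ^ 6 * L ^ 6"
proof -
  let ?q = "L / ln 2"
  have ln2: "0 < ln (2 :: real)" "ln (2 :: real) \<le> 1" using ln_le_minus_one[of "2::real"] by auto
  have q: "1 \<le> ?q" using assms ln2 by (simp add: field_simps)
  then have "1 \<le> ?q ^ 6" "?q \<le> ?q ^ 6" by (auto intro: self_le_power)
  moreover have "L \<le> ?q" using assms(1) ln2 mult_left_le[of "ln 2" L] by (simp add: pos_le_divide_eq order.trans[of 0 "ln 2" L])
  ultimately have "a * 1 \<le> a * ?q ^ 6" "b * L \<le> b * ?q ^ 6"
    using assms by (intro mult_left_mono; linarith)+
  then have "a + b * L \<le> (a + b) * ?q ^ 6" by (simp add: algebra_simps)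
  then show ?thesis by (simp add: power_divide)
qed

theorem theorem1p1:
  shows "\<exists>alg :: stream_alg. \<forall>d :: nat. \<exists>(c :: real) (k :: nat).
    \<forall>(n :: nat) (E :: edge set) (f :: edge set \<Rightarrow> real) (xs :: (nat \<times> nat) list).
      graph n E \<longrightarrow> nonneg_on E f \<longrightarrow> submodular_on E f \<longrightarrow> mono_on (Pow E) f \<longrightarrow>
      poly_bounded d n E f \<longrightarrow> is_stream_of E xs \<longrightarrow>
      (\<exists>tr M. runs alg f n xs tr M
        \<and> real (length tr) \<le> c * (real (card E) + 1) * ln (real (card E) + 2) ^ k
        \<and> (\<forall>s\<in>set tr. real (space s) \<le> c * (real (M_max E) + 1) * ln (real n + 2) ^ k
              \<and> fits_words ((n + 2) ^ k) (f_max E f) s)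
        \<and> matching E M
        \<and> (\<forall>OPT. is_arg_max f (matching E) OPT \<longrightarrow> f M \<ge> 1 / (3 + 2 * sqrt 2) * f OPT))"
proof (rule exI[of _ stack_alg], rule allI, rule exI, rule exI[of _ 6], intro allI impI)
  fix d n :: nat and E :: "edge set" and f :: "edge set \<Rightarrow> real" and xs :: "(nat \<times> nat) list"
  assume g: "graph n E" "nonneg_on E f" "submodular_on E f" "mono_on (Pow E) f"
    and pb: "poly_bounded d n E f" and xs: "is_stream_of E xs"
  interpret msm n E f by unfold_locales (fact g)+
  \<comment> \<open>These constants expand \<open>12 * length S + 20\<close> by
    \<open>length_stack_le\<close>: 24 is \<open>12 * 2\<close>, and 92 is
    \<open>12 * 2 * 3 + 20\<close>.\<close>
  let ?b = "24 * real d / ln C" and ?L = "ln (real n + 2)" and ?m = "real (M_max E) + 1"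
  let ?c = "(92 + ?b) / ln 2 ^ 6"
  have b0: "0 \<le> ?b" using C_gt_1 by simp
  \<comment> \<open>The floor turns the real space bound into a natural number without loss, as
    \<open>12 * length S + 20\<close> is an integer.\<close>
  define K where "K = nat \<lfloor>?c * ?m * ?L ^ 6\<rfloor>"
  have K: "12 * length S + 20 \<le> K" if "inv P S \<phi>" for P S \<phi>
  proof -
    have "real (length S) \<le> 2 * real (M_max E) * (3 + real d * (?L / ln C))"
      by (rule length_stack_le[OF that pb])
    also have "\<dots> \<le> 2 * ?m * (3 + real d * (?L / ln C))"
      using C_gt_1 by (intro mult_right_mono) (auto intro!: add_nonneg_nonneg)
    finally have "12 * real (length S) \<le> 12 * (2 * ?m * (3 + real d * (?L / ln C)))" by simp
    also have "\<dots> = ?m * (72 + ?b * ?L)" by (simp add: algebra_simps)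
    finally have "real (12 * length S + 20) \<le> ?m * (72 + ?b * ?L) + 20 * 1" by simp
    also have "\<dots> \<le> ?m * (72 + ?b * ?L) + 20 * ?m" by (intro add_left_mono mult_left_mono) auto
    also have "\<dots> = ?m * (92 + ?b * ?L)" by (simp add: algebra_simps)
    also have "\<dots> \<le> ?m * (?c * ?L ^ 6)"
      using b0 by (intro mult_left_mono ln_power_bound) auto
    finally have "real (12 * length S + 20) \<le> ?c * ?m * ?L ^ 6" by (simp only: mult_ac)
    then show ?thesis unfolding K_def by linarith
  qed
  have K': "real K \<le> ?c * ?m * ?L ^ 6"
    unfolding K_def using b0 by (intro of_nat_floor) (auto intro!: mult_nonneg_nonneg divide_nonneg_nonneg)
  have N: "n + 2 \<le> (n + 2) ^ 6" "16 + 4 * card E \<le> (n + 2) ^ 6"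
  proof -
    show "n + 2 \<le> (n + 2) ^ 6" by (rule self_le_power) auto
    \<comment> \<open>The word size dictates the exponent 6: two powers cover the at most
      \<open>n\<^sup>2\<close> edges, and four cover the factor 16.\<close>
    have "2 ^ 4 * (n + 2)\<^sup>2 \<le> (n + 2) ^ 4 * (n + 2)\<^sup>2"
      by (intro mult_right_mono power_mono) auto
    also have "\<dots> = (n + 2) ^ 6" by (simp add: power_add[symmetric])
    finally have "16 * (n + 2)\<^sup>2 \<le> (n + 2) ^ 6" by simp
    moreover have "16 + 4 * card E \<le> 16 * (n + 2)\<^sup>2"
      using card_E by (simp add: power2_eq_square algebra_simps)
    ultimately show "16 + 4 * card E \<le> (n + 2) ^ 6" by linarith
  qed
  obtain tr M where r: "runs stack_alg f n xs tr M" "length tr \<le> 18 * card E + 5"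
      "\<forall>s\<in>set tr. space s \<le> K \<and> fits_words ((n + 2) ^ 6) (f_max E f) s" "matching E M"
      "\<forall>R. matching E R \<longrightarrow> f M \<ge> 1 / (3 + 2 * sqrt 2) * f R"
    using run_stack_alg[OF xs N] K by blast
  have time: "real (length tr) \<le> ?c * (real (card E) + 1) * ln (real (card E) + 2) ^ 6"
  proof -
    let ?l = "ln (real (card E) + 2)"
    have "real (length tr) \<le> 18 * (real (card E) + 1)" using r(2) by simp
    \<comment> \<open>The time is linear; it is enlarged here to share its constant with the space
      bound.\<close>
    also have "\<dots> \<le> (92 + ?b * ?l) * (real (card E) + 1)"
      using mult_nonneg_nonneg[OF b0, of ?l] by (intro mult_right_mono) auto
    also have "\<dots> \<le> (?c * ?l ^ 6) * (real (card E) + 1)"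
      using b0 by (intro mult_right_mono ln_power_bound) auto
    finally show ?thesis by (simp only: mult_ac)
  qed
  have "real (space s) \<le> ?c * ?m * ?L ^ 6" if "s \<in> set tr" for s
    using r(3) that K' by (meson of_nat_le_iff order.trans)
  then show "\<exists>tr M. runs stack_alg f n xs tr M
      \<and> real (length tr) \<le> ?c * (real (card E) + 1) * ln (real (card E) + 2) ^ 6
      \<and> (\<forall>s\<in>set tr. real (space s) \<le> ?c * ?m * ?L ^ 6
            \<and> fits_words ((n + 2) ^ 6) (f_max E f) s)
      \<and> matching E M
      \<and> (\<forall>OPT. is_arg_max f (matching E) OPT \<longrightarrow> f M \<ge> 1 / (3 + 2 * sqrt 2) * f OPT)"
    using r time unfolding is_arg_max_def by blast
qed

end
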